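(* Let $C$ be a $d$-variate copula in the domain of attraction of an extreme-value copula $C_\infty$ with stable tail dependence function $L$, and let $\Gamma_1,\Gamma_2$ be the functions associated with $L$, and the POT and BM second order conditions for $C$ be as defined in the context. Let $L_\vee(\boldsymbol x)=\max(x_1,\dots,x_d)$. (a) Suppose that the POT second order condition holds with functions $\alpha_p, S_p$, where $\alpha_p$ is regularly varying of order $\rho_p\le 0$, and assume that $\lim_{r\to\infty} 2r\alpha_p(r)=c_p\in[0,\infty]$ exists. (i) If $c_p=\infty$, then the BM second order condition holds with $\alpha_b\equiv\alpha_p$ and $S_b(e^{-\boldsymbol x})=-C_\infty(e^{-\boldsymbol x})S_p(\boldsymbol x)$, $\boldsymbol x\in[0,\infty)^d$. (ii) If $c_p=0$ and $L\neq L_\vee$, then the BM second order condition holds (for some $\alpha_b,S_b$) if and only if $\Gamma_2$ is continuous. In that case one may choose $\alpha_b(r)=(2r)^{-1}$ and $S_b(e^{-\boldsymbol x})=C_\infty(e^{-\boldsymbol x})\{\Gamma_2(\boldsymbol x)-L^2(\boldsymbol x)\}$. (iii) If $c_p\in(0,\infty)$, $\Gamma_2$ is continuous, and the function $S_b$ defined by $$S_b(e^{-\boldsymbol x})=C_\infty(e^{-\boldsymbol x})\big\{\lambda_p\{\Gamma_2(\boldsymbol x)-L^2(\boldsymbol x)\}-(1-\lambda_p)S_p(\boldsymbol x)\big\},\qquad \lambda_p=\frac1{1+c_p},$$ is not the null function, then the BM second order condition holds with $\alpha_b(r)=\alpha_p(r)+\frac1{2r}$ and this $S_b$. (b) Suppose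 that the BM second order condition holds with functions $\alpha_b,S_b$, where $\alpha_b$ is regularly varying of order $\rho_b\le0$, and assume that $\lim_{r\to\infty}2r\alpha_b(r)=c_b\in[0,\infty]$ exists. (i) If $c_b=\infty$, then the POT second order condition holds with $\alpha_p\equiv\alpha_b$ and $S_p(\boldsymbol x)=-S_b(e^{-\boldsymbol x})/C_\infty(e^{-\boldsymbol x})$. (ii) If $c_b=0$ and $L\ne L_\vee$, then the POT second order condition holds (for some $\alpha_p,S_p$) if and only if $\Gamma_1$ is continuous. In that case one may choose $\alpha_p(r)=(2r)^{-1}$ and $S_p(\boldsymbol x)=\Gamma_1(\boldsymbol x)-L^2(\boldsymbol x)$. (iii) If $c_b\in(0,\infty)$, $\Gamma_1$ is continuous, and the function $S_p$ defined by $$S_p(\boldsymbol x)=\lambda_b\{\Gamma_1(\boldsymbol x)-L^2(\boldsymbol x)\}-(1-\lambda_b)\frac{S_b(e^{-\boldsymbol x})}{C_\infty(e^{-\boldsymbol x})},\qquad \lambda_b=\frac1{1+c_b},$$ is not the null function, then the POT second order condition holds with $\alpha_p(r)=\alpha_b(r)+\frac1{2r}$ and this $S_p$.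
   Context: Operations on vectors are componentwise: $\boldsymbol u^{s}=(u_1^s,\dots,u_d^s)$, $\boldsymbol x^2=(x_1^2,\dots,x_d^2)$, $e^{-\boldsymbol x}=(e^{-x_1},\dots,e^{-x_d})$; $\boldsymbol 1=(1,\dots,1)$. A copula $C$ on $[0,1]^d$ is extended to a c.d.f. on $[-\infty,\infty]^d$ in the natural way. Domain of attraction: $C_\infty$ is an extreme-value copula and $\lim_{r\to\infty}C(\boldsymbol u^{1/r})^r=C_\infty(\boldsymbol u)$ for all $\boldsymbol u\in[0,1]^d$. Then $C_\infty(\boldsymbol u)=\exp\{-L(-\log u_1,\dots,-\log u_d)\}$, where $L$ is the stable tail dependence function; $L$ is homogeneous of order 1, convex, satisfies $L(\boldsymbol e_j)=1$ for the unit vectors $\boldsymbol e_j$ and $\max_j x_j\le L(\boldsymbol x)\le\sum_j x_j$. The domain of attraction assumption is equivalent to $\lim_{t\to\infty}t\{1-C(\boldsymbol 1-\boldsymbol x/t)\}=L(\boldsymbol x)$ for all $\boldsymbol x$. $L^2(\boldsymbol x)$ means $(L(\boldsymbol x))^2$. POT second order condition with $(\alpha_p,S_p)$: $\alpha_p:(0,\infty)\to(0,\infty)$ satisfies $\lim_{t\to\infty}\alpha_p(t)=0$, $S_p$ is a non-null (not identically zero) real function on $[0,\infty)^d$, and $$\lim_{t\to\infty}\frac{t\{1-C(\boldsymbol 1-\boldsymbol x/t)\}-L(\boldsymbol x)}{\alpha_p(t)}=S_p(\boldsymbol x),\quad \boldsymbol x\in[0,\infty)^d,$$ uniformly on $[0,T]^d$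 for every fixed $T>0$. BM second order condition with $(\alpha_b,S_b)$: $\alpha_b:(0,\infty)\to(0,\infty)$ satisfies $\lim_{r\to\infty}\alpha_b(r)=0$, $S_b$ is a non-null real function on $[0,1]^d$, and $$\lim_{r\to\infty}\frac{C(\boldsymbol u^{1/r})^r-C_\infty(\boldsymbol u)}{\alpha_b(r)}=S_b(\boldsymbol u),\quad \boldsymbol u\in[0,1]^d,$$ uniformly on $[\delta,1]^d$ for each $\delta>0$. (If some coordinate of $\boldsymbol u$ is zero, both $C(\boldsymbol u^{1/r})^r$ and $C_\infty(\boldsymbol u)$ vanish, so $S_b(\boldsymbol u)=0$ there; thus $S_b$ is specified by its values $S_b(e^{-\boldsymbol x})$, $\boldsymbol x\in[0,\infty)^d$.) For $\boldsymbol x\in[0,\infty)^d$, $$\Gamma_1(\boldsymbol x)=\lim_{r\to\infty}r\{L(\boldsymbol x+\boldsymbol x^2/r)-L(\boldsymbol x)\},\qquad \Gamma_2(\boldsymbol x)=\lim_{r\to\infty}r\{L(\boldsymbol x)-L(\boldsymbol x-\boldsymbol x^2/r)\};$$ both limits exist by convexity and Lipschitz continuity of $L$. A function $f:(0,\infty)\to(0,\infty)$ is regularly varying of order $\rho\in\mathbb R$ if $\lim_{t\to\infty}f(tx)/f(t)=x^\rho$ for all $x>0$. *)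

theory Defs
  imports "HOL-Probability.Probability"
begin

text \<open>
  Vectors are elements of \<open>real ^ 'n\<close>, with \<open>d = CARD('n)\<close>. The order, the constants \<open>0\<close>, \<open>1\<close>
  and \<open>vec a\<close>, and the square \<open>x\<^sup>2\<close> of the library are componentwise, so that \<open>{0..}\<close> is
  $[0,\infty)^d$, \<open>{0..1}\<close> is $[0,1]^d$ and \<open>{vec \<delta>..1}\<close> is $[\delta,1]^d$.
\<close>

lemma power2_vec_component: "(x\<^sup>2 :: real ^ 'n) $ i = (x $ i)\<^sup>2"
  by (simp add: power2_eq_square)

definition vexp :: "real ^ 'n \<Rightarrow> real ^ 'n" where
  "vexp x = (\<chi> i. exp (x $ i))"

definition vpowr :: "real ^ 'n \<Rightarrow> real \<Rightarrow> real ^ 'n" where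
  "vpowr u s = (\<chi> i. (u $ i) powr s)"

text \<open>
  A copula is represented by its extension to a c.d.f.\ on the whole space: it is the joint
  distribution function of a random vector whose components are uniform on $[0,1]$.
\<close>

definition copula :: "(real ^ 'n \<Rightarrow> real) \<Rightarrow> bool" where
  "copula C \<longleftrightarrow>
     (\<exists>M. prob_space M \<and> sets M = sets (borel :: (real ^ 'n) measure) \<and>
          (\<forall>i. distr M borel (\<lambda>x. x $ i) = uniform_measure lborel {0..1}) \<and>
          (\<forall>x. C x = measure M {..x}))"

text \<open>Extreme-value copulas are the max-stable copulas.\<close>

definition extreme_value_copula :: "(real ^ 'n \<Rightarrow> real) \<Rightarrow> bool" where
  "extreme_value_copula C \<longleftrightarrow>
     copula C \<and> (\<forall>r>0. \<forall>u\<in>{0..1}. C (vpowr u (1 / r)) powr r = C u)"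

definition domain_of_attraction :: "(real ^ 'n \<Rightarrow> real) \<Rightarrow> (real ^ 'n \<Rightarrow> real) \<Rightarrow> bool" where
  "domain_of_attraction C Cinf \<longleftrightarrow>
     extreme_value_copula Cinf \<and>
     (\<forall>u\<in>{0..1}. ((\<lambda>r. C (vpowr u (1 / r)) powr r) \<longlongrightarrow> Cinf u) at_top)"

text \<open>
  The values of \<open>L\<close> outside \<open>{0..}\<close> are irrelevant. Points \<open>u\<close> with a zero coordinate, where
  $-\log u_j = \infty$, are left out: \<open>Cinf\<close> vanishes there.
\<close>

definition stable_tail_dependence ::
  "(real ^ 'n \<Rightarrow> real) \<Rightarrow> (real ^ 'n \<Rightarrow> real) \<Rightarrow> bool" where
  "stable_tail_dependence Cinf L \<longleftrightarrow>
     (\<forall>u\<in>{0..1}. (\<forall>i. 0 < u $ i) \<longrightarrow> Cinf u = exp (- L (\<chi> i. - ln (u $ i))))"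

definition L_max :: "real ^ 'n \<Rightarrow> real" where
  "L_max x = Max (range (\<lambda>i. x $ i))"

definition POT_second_order ::
  "(real ^ 'n \<Rightarrow> real) \<Rightarrow> (real ^ 'n \<Rightarrow> real) \<Rightarrow> (real \<Rightarrow> real) \<Rightarrow> (real ^ 'n \<Rightarrow> real) \<Rightarrow> bool" where
  "POT_second_order C L \<alpha> S \<longleftrightarrow>
     (\<forall>t>0. 0 < \<alpha> t) \<and> (\<alpha> \<longlongrightarrow> 0) at_top \<and> (\<exists>x\<in>{0..}. S x \<noteq> 0) \<and>
     (\<forall>x\<in>{0..}. ((\<lambda>t. (t * (1 - C (1 - x /\<^sub>R t)) - L x) / \<alpha> t) \<longlongrightarrow> S x) at_top) \<and>
     (\<forall>T>0. uniform_limit {0..vec T}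
              (\<lambda>t x. (t * (1 - C (1 - x /\<^sub>R t)) - L x) / \<alpha> t) S at_top)"

definition BM_second_order ::
  "(real ^ 'n \<Rightarrow> real) \<Rightarrow> (real ^ 'n \<Rightarrow> real) \<Rightarrow> (real \<Rightarrow> real) \<Rightarrow> (real ^ 'n \<Rightarrow> real) \<Rightarrow> bool" where
  "BM_second_order C Cinf \<alpha> S \<longleftrightarrow>
     (\<forall>r>0. 0 < \<alpha> r) \<and> (\<alpha> \<longlongrightarrow> 0) at_top \<and> (\<exists>u\<in>{0..1}. S u \<noteq> 0) \<and>
     (\<forall>u\<in>{0..1}. ((\<lambda>r. (C (vpowr u (1 / r)) powr r - Cinf u) / \<alpha> r) \<longlongrightarrow> S u) at_top) \<and>
     (\<forall>\<delta>>0. uniform_limit {vec \<delta>..1}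
              (\<lambda>r u. (C (vpowr u (1 / r)) powr r - Cinf u) / \<alpha> r) S at_top)"

text \<open>
  The function on $[0,1]^d$ whose value at $e^{-x}$ is $g(x)$ for \<open>x \<ge> 0\<close>, and which is \<open>0\<close> as
  soon as some coordinate is zero.
\<close>

definition of_neg_log :: "(real ^ 'n \<Rightarrow> real) \<Rightarrow> real ^ 'n \<Rightarrow> real" where
  "of_neg_log g u = (if \<forall>i. 0 < u $ i then g (\<chi> i. - ln (u $ i)) else 0)"

lemma of_neg_log_vexp: "of_neg_log g (vexp (- x)) = g x"
  by (simp add: of_neg_log_def vexp_def vec_eq_iff)

definition Gamma1 :: "(real ^ 'n \<Rightarrow> real) \<Rightarrow> real ^ 'n \<Rightarrow> real" where
  "Gamma1 L x = Lim at_top (\<lambda>r::real. r * (L (x + x\<^sup>2 /\<^sub>R r) - L x))"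

definition Gamma2 :: "(real ^ 'n \<Rightarrow> real) \<Rightarrow> real ^ 'n \<Rightarrow> real" where
  "Gamma2 L x = Lim at_top (\<lambda>r::real. r * (L x - L (x - x\<^sup>2 /\<^sub>R r)))"

definition regularly_varying :: "(real \<Rightarrow> real) \<Rightarrow> real \<Rightarrow> bool" where
  "regularly_varying f \<rho> \<longleftrightarrow>
     (\<forall>t>0. 0 < f t) \<and> (\<forall>x>0. ((\<lambda>t. f (t * x) / f t) \<longlongrightarrow> x powr \<rho>) at_top)"

end

theory Submission
  imports Defs "HOL-Real_Asymp.Real_Asymp"
begin

text \<open>
  Put \<open>F\<^sub>r(x) = r (1 - C(1 - x/r))\<close> and \<open>G\<^sub>r(x) = - log (C(e\<^sup>-\<^sup>x\<^sup>/\<^sup>r)\<^sup>r)\<close>. Both converge to \<open>L\<close>.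
  The POT condition is a rate of convergence for \<open>F\<^sub>r - L\<close>; the BM condition is one for
  \<open>exp(-G\<^sub>r) - exp(-L)\<close>, that is, by the mean value theorem, for \<open>G\<^sub>r - L\<close>. The two families are
  linked by an exact identity. With
  \<open>\<phi>\<^sub>r(v) = - r log (1 - v/r) = v + v\<^sup>2/(2r) + \<dots>\<close> and its inverse
  \<open>\<psi>\<^sub>r(v) = r (1 - e\<^sup>-\<^sup>v\<^sup>/\<^sup>r) = v - v\<^sup>2/(2r) + \<dots>\<close>, acting componentwise on vectors,
  \<open>G\<^sub>r(x) = \<phi>\<^sub>r(F\<^sub>r(\<psi>\<^sub>r x))\<close> and \<open>F\<^sub>r(x) = \<psi>\<^sub>r(G\<^sub>r(\<phi>\<^sub>r x))\<close>.

  In the first identity the outer function contributes \<open>L\<^sup>2/(2r)\<close>, and the inner one replaces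
  \<open>L(x)\<close> by \<open>L(x - x\<^sup>2/(2r)) \<approx> L(x) - \<Gamma>\<^sub>2(x)/(2r)\<close>. Hence
  \<open>G\<^sub>r - L \<approx> \<alpha>(r) S + (L\<^sup>2 - \<Gamma>\<^sub>2)/(2r)\<close>, and the second identity gives in the same way
  \<open>F\<^sub>r - L \<approx> \<alpha>(r) S' - (L\<^sup>2 - \<Gamma>\<^sub>1)/(2r)\<close>. The three cases of each part say which of the two
  terms dominates. Both directions are instances of \<open>second_order_change_of_scale\<close>, with
  a sign \<open>\<sigma> = 1\<close> or \<open>\<sigma> = -1\<close>.

  The approximation has to be uniform on bounded sets. Since \<open>L\<close> is convex, the difference quotients
  that define \<open>\<Gamma>\<^sub>1\<close> and \<open>-\<Gamma>\<^sub>2\<close> decrease in \<open>r\<close>, so by Dini's theorem they converge uniformly on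
  bounded sets as soon as the limit is continuous. Continuity is also necessary when
  \<open>2r \<alpha>(r) \<rightarrow> 0\<close>: \<open>2r\<close> times the difference then converges pointwise to an explicit function of
  \<open>L\<close> and \<open>\<Gamma>\<^sub>i\<close>, and a second order condition with any rate forces that function to be a constant
  multiple of a locally uniform limit of continuous functions
  (\<open>pointwise_limit_continuous_of_uniform_ratio\<close>).

  The limit is not null when \<open>L\<close> is not the maximum: by homogeneity \<open>\<Gamma>\<^sub>1(1) = \<Gamma>\<^sub>2(1) = L(1)\<close>, so
  \<open>\<Gamma>\<^sub>i(1) - L(1)\<^sup>2 = L(1) (1 - L(1))\<close>, and \<open>L(1) = 1\<close> would force \<open>L\<close> to be the maximum.

  The properties of \<open>L\<close> come from max-stability. Homogeneity is immediate; with subadditivity it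
  yields convexity, and monotonicity and \<open>L(e\<^sub>j) = 1\<close> then give the Lipschitz bound.
  Subadditivity is the step with content: if \<open>U\<close> has distribution function \<open>Cinf\<close>, then \<open>Z\<^sub>x = max\<^sub>i x\<^sub>i / (- log U\<^sub>i)\<close> is a Frechet
  variable with scale \<open>L(x)\<close>, so that \<open>E Z\<^sub>x\<^sup>p\<close> is a constant times \<open>L(x)\<^sup>p\<close> for \<open>p < 1\<close>;
  as \<open>Z\<close> is subadditive in \<open>x\<close>, so is \<open>L\<^sup>p\<close>, and \<open>p\<close> tends to 1.
\<close>

section \<open>Copulas as distribution functions\<close>

text \<open>
  The random vectors behind copulas. A copula is read as \<open>u \<mapsto> prob {..u}\<close>, which turns its
  analytic properties into inclusions of events.
\<close>

locale uniform_margins = prob_space M for M :: "(real ^ 'n) measure" +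
  assumes sets_M: "sets M = sets borel"
    and distr_component: "distr M borel (\<lambda>x. x $ i) = uniform_measure lborel {0..1}"
begin

lemma space_M: "space M = UNIV"
  using sets_eq_imp_space_eq[OF sets_M] by simp

lemma measurable_component [measurable]: "(\<lambda>x. x $ i) \<in> borel_measurable M"
  by (simp add: measurable_cong_sets[OF sets_M refl])

lemma component_event: "A \<in> sets borel \<Longrightarrow> {x. x $ i \<in> A} \<in> events"
  using measurable_sets[OF measurable_component, of A i] space_M by (simp add: vimage_def)

lemma atMost_event [simp]: "{..u} \<in> events"
  by (simp add: sets_M borel_closed)

lemma prob_component:
  assumes "A \<in> sets borel"
  shows "prob {x. x $ i \<in> A} = measure lborel ({0..1} \<inter> A)"
proof -
  have "prob {x. x $ i \<in> A} = measure (distr M borel (\<lambda>x. x $ i)) A"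
    using measure_distr[OF measurable_component assms, of i] space_M by (simp add: vimage_def)
  also have "\<dots> = measure lborel ({0..1} \<inter> A)"
    using assms by (simp add: distr_component measure_def divide_ennreal_def)
  finally show ?thesis .
qed

lemma AE_component_less: "AE x in M. 0 < x $ i \<and> x $ i < 1"
proof -
  have "{0..1} \<inter> {0<..<1} = {0<..<1::real}" by auto
  then have "prob {x. x $ i \<in> {0<..<1}} = 1"
    using prob_component[of "{0<..<1}" i] by simp
  then show ?thesis
    using prob_eq_1[OF component_event[of "{0<..<1}" i]] by simp
qed

end

lemma copula_vector:
  assumes "copula C"
  obtains M where "uniform_margins M" "\<And>x. C x = measure M {..x}"
  using assms unfolding copula_def uniform_margins_def uniform_margins_axioms_def by metis

lemma copula_nonneg: "copula C \<Longrightarrow> 0 \<le> C u"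
  by (metis copula_def measure_nonneg)

text \<open>
  The orthant below \<open>u\<close> is covered by the orthant below \<open>v\<close> and the slabs \<open>v\<^sub>i < x\<^sub>i \<le> u\<^sub>i\<close>, whose
  probability is at most \<open>\<bar>u\<^sub>i - v\<^sub>i\<bar>\<close> because the margins are uniform.
\<close>

lemma copula_le_plus:
  fixes C :: "real ^ 'n \<Rightarrow> real"
  assumes "copula C"
  shows "C u \<le> C v + (\<Sum>i\<in>UNIV. \<bar>u $ i - v $ i\<bar>)"
proof -
  obtain M where M: "uniform_margins M" and C: "\<And>x. C x = measure M {..x}"
    using copula_vector[OF assms] by blast
  interpret uniform_margins M by fact
  have slab: "prob {x. x $ i \<in> {v $ i<..u $ i}} \<le> \<bar>u $ i - v $ i\<bar>" for i
  proof (cases "v $ i \<le> u $ i")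
    case True
    then have "measure lborel ({0..1} \<inter> {v $ i<..u $ i}) \<le> measure lborel {v $ i<..u $ i}"
      by (intro measure_mono_fmeasurable) (auto simp: fmeasurable_def)
    then show ?thesis using prob_component[of "{v $ i<..u $ i}" i] True by simp
  qed simp
  have ev: "{x. x $ i \<in> {v $ i<..u $ i}} \<in> events" for i
    by (rule component_event) simp
  have "C u \<le> prob ({..v} \<union> (\<Union>i. {x. x $ i \<in> {v $ i<..u $ i}}))"
    unfolding C
    by (rule finite_measure_mono)
      (use ev in \<open>auto simp: less_eq_vec_def not_le not_less\<close>)
  also have "\<dots> \<le> prob {..v} + prob (\<Union>i. {x. x $ i \<in> {v $ i<..u $ i}})"
    using ev by (intro measure_Un_le) auto
  also have "\<dots> \<le> C v + (\<Sum>i\<in>UNIV. prob {x. x $ i \<in> {v $ i<..u $ i}})"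
    unfolding C using ev by (intro add_left_mono finite_measure_subadditive_finite) auto
  also have "\<dots> \<le> C v + (\<Sum>i\<in>UNIV. \<bar>u $ i - v $ i\<bar>)"
    by (intro add_left_mono sum_mono slab)
  finally show ?thesis .
qed

lemma copula_mono:
  fixes C :: "real ^ 'n \<Rightarrow> real"
  assumes "copula C" "u \<le> v"
  shows "C u \<le> C v"
proof -
  obtain M where M: "uniform_margins M" and C: "\<And>x. C x = measure M {..x}"
    using copula_vector[OF assms(1)] by blast
  interpret uniform_margins M by fact
  show ?thesis unfolding C
    by (rule finite_measure_mono) (use assms(2) in auto)
qed

lemma copula_le_component:
  fixes C :: "real ^ 'n \<Rightarrow> real"
  assumes "copula C" "0 \<le> u $ i"
  shows "C u \<le> u $ i"
proof -
  obtain M where M: "uniform_margins M" and C: "\<And>x. C x = measure M {..x}"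
    using copula_vector[OF assms(1)] by blast
  interpret uniform_margins M by fact
  have "C u \<le> prob {x. x $ i \<in> {..u $ i}}"
    unfolding C using component_event[of "{..u $ i}" i]
    by (intro finite_measure_mono) (auto simp: less_eq_vec_def)
  also have "\<dots> = measure lborel ({0..1} \<inter> {..u $ i})"
    by (rule prob_component) auto
  also have "\<dots> \<le> measure lborel {0..u $ i}"
    by (rule measure_mono_fmeasurable) (use assms in \<open>auto simp: fmeasurable_def\<close>)
  also have "\<dots> = u $ i" using assms by simp
  finally show ?thesis .
qed

lemma copula_one:
  fixes C :: "real ^ 'n \<Rightarrow> real"
  assumes "copula C"
  shows "C 1 = 1"
proof -
  obtain M where M: "uniform_margins M" and C: "\<And>x. C x = measure M {..x}"
    using copula_vector[OF assms(1)] by blast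
  interpret uniform_margins M by fact
  have "AE x in M. \<forall>i. x $ i \<le> 1"
    unfolding AE_all_countable
  proof
    fix i
    show "AE x in M. x $ i \<le> 1" using AE_component_less[of i] by eventually_elim simp
  qed
  then have "AE x in M. x \<in> {..1}"
    by (simp add: less_eq_vec_def)
  then show "C 1 = 1" using prob_eq_1[of "{..1}"] C by simp
qed

section \<open>Sublinearity of the stable tail dependence function\<close>

lemma powr_add_le_add_powr:
  fixes a b p :: real
  assumes "0 \<le> a" "0 \<le> b" "0 < p" "p \<le> 1"
  shows "(a + b) powr p \<le> a powr p + b powr p"
proof (cases "a = 0 \<or> b = 0")
  case True
  then show ?thesis using assms by auto
next
  case False
  define s where "s = a + b"
  have ab: "0 < a" "0 < b" "0 < s" using False assms by (auto simp: s_def)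
  have le: "c / s \<le> c powr p / s powr p" if "0 < c" "c \<le> s" for c
  proof -
    have "(c / s) powr 1 \<le> (c / s) powr p"
      using assms that ab by (intro powr_mono') auto
    then show ?thesis using that ab by (simp add: powr_divide)
  qed
  have "1 = (a + b) / s" using ab by (simp add: s_def)
  also have "\<dots> = a / s + b / s" by (simp add: add_divide_distrib)
  also have "\<dots> \<le> a powr p / s powr p + b powr p / s powr p"
    using ab by (intro add_mono le) (auto simp: s_def)
  finally have "1 \<le> (a powr p + b powr p) / s powr p" by (simp add: add_divide_distrib)
  then show ?thesis using ab by (simp add: s_def field_simps)
qed

text \<open>
  If \<open>U\<close> is uniform, then \<open>1 / (- log U)\<close> has the standard Frechet distribution function
  \<open>t \<mapsto> exp (- 1 / t)\<close>. The value 0 off the open unit interval only concerns a null set.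
\<close>

definition frechet_of :: "real \<Rightarrow> real" where
  "frechet_of s = (if 0 < s \<and> s < 1 then 1 / (- ln s) else 0)"

lemma frechet_of_measurable [measurable]: "frechet_of \<in> borel_measurable borel"
  unfolding frechet_of_def by measurable

lemma frechet_of_nonneg: "0 \<le> frechet_of s"
  by (simp add: frechet_of_def)

lemma frechet_of_le_iff:
  assumes "0 < s" "s < 1" "0 < t"
  shows "c * frechet_of s \<le> t \<longleftrightarrow> s \<le> exp (- (c / t))"
proof -
  have "c * frechet_of s = c / (- ln s)" "0 < - ln s"
    using assms by (auto simp: frechet_of_def)
  then have "c * frechet_of s \<le> t \<longleftrightarrow> c \<le> t * (- ln s)"
    by (simp only: pos_divide_le_eq)
  also have "\<dots> \<longleftrightarrow> c / t \<le> - ln s"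
    using assms(3) by (simp add: pos_divide_le_eq mult.commute)
  also have "\<dots> \<longleftrightarrow> ln s \<le> - (c / t)"
    by linarith
  also have "\<dots> \<longleftrightarrow> s \<le> exp (- (c / t))"
    using assms by (metis exp_le_cancel_iff exp_ln)
  finally show ?thesis .
qed

definition weighted_max :: "real ^ 'n \<Rightarrow> real ^ 'n \<Rightarrow> real" where
  "weighted_max x u = Max (range (\<lambda>i. x $ i * frechet_of (u $ i)))"

lemma weighted_max_le_iff:
  "weighted_max x u \<le> t \<longleftrightarrow> (\<forall>i. x $ i * frechet_of (u $ i) \<le> t)"
  unfolding weighted_max_def by (subst Max_le_iff) auto

lemma component_le_weighted_max: "x $ i * frechet_of (u $ i) \<le> weighted_max x u"
  using weighted_max_le_iff[of x u "weighted_max x u"] by simp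

lemma weighted_max_nonneg: "0 \<le> x \<Longrightarrow> 0 \<le> weighted_max x u"
  using component_le_weighted_max[of x undefined u]
  by (simp add: less_eq_vec_def) (meson frechet_of_nonneg mult_nonneg_nonneg order_trans)

lemma weighted_max_add_le: "weighted_max (x + y) u \<le> weighted_max x u + weighted_max y u"
  unfolding weighted_max_le_iff[of "x + y"]
  by (simp add: distrib_right add_mono component_le_weighted_max)

lemma weighted_max_axis:
  "0 \<le> c \<Longrightarrow> weighted_max (c *\<^sub>R axis j 1) u = c * frechet_of (u $ j)"
  by (rule antisym)
    (use component_le_weighted_max[of "c *\<^sub>R axis j 1" j u] in
      \<open>auto simp: weighted_max_le_iff axis_def frechet_of_nonneg\<close>)

context uniform_margins
begin

lemma weighted_max_measurable [measurable]: "weighted_max x \<in> borel_measurable M"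
proof (rule borel_measurableI_le)
  fix t
  have "{u \<in> space M. weighted_max x u \<le> t} = {u \<in> space M. \<forall>i. x $ i * frechet_of (u $ i) \<le> t}"
    by (simp add: weighted_max_le_iff)
  also have "\<dots> \<in> events" by measurable
  finally show "{u \<in> space M. weighted_max x u \<le> t} \<in> events" .
qed

text \<open>
  Up to a null set the event is an orthant, hence its probability is a value of the copula.
\<close>

lemma prob_weighted_max_le:
  assumes "0 < t"
  shows "prob {u \<in> space M. weighted_max x u \<le> t} = prob {..vexp (- (x /\<^sub>R t))}"
proof (rule finite_measure_eq_AE)
  have "AE u in M. \<forall>i. 0 < u $ i \<and> u $ i < 1"
    unfolding AE_all_countable using AE_component_less by blast
  then show "AE u in M. u \<in> {u \<in> space M. weighted_max x u \<le> t} \<longleftrightarrow> u \<in> {..vexp (- (x /\<^sub>R t))}"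
    by eventually_elim
      (use assms in \<open>simp add: weighted_max_le_iff frechet_of_le_iff space_M less_eq_vec_def
        vexp_def divide_inverse mult.commute\<close>)
qed auto

lemma frechet_moment_pos:
  assumes "0 < p"
  shows "(\<integral>\<^sup>+u. ennreal (frechet_of (u $ j) powr p) \<partial>M) \<noteq> 0"
proof
  assume "(\<integral>\<^sup>+u. ennreal (frechet_of (u $ j) powr p) \<partial>M) = 0"
  then have "AE u in M. ennreal (frechet_of (u $ j) powr p) = 0"
    by (subst (asm) nn_integral_0_iff_AE) auto
  then have "AE u in M. False"
    using AE_component_less[of j] by eventually_elim (auto simp: frechet_of_def)
  then show False by simp
qed

text \<open>
  From \<open>- log s \<ge> 1 - s\<close> the moment is dominated by \<open>\<integral>\<^sub>0\<^sup>1 (1 - s)\<^sup>-\<^sup>p ds\<close>, which is finite for \<open>p < 1\<close>.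
  The first moment is infinite, which is why exponents below 1 are used.
\<close>

lemma frechet_moment_finite:
  assumes "0 < p" "p < 1"
  shows "(\<integral>\<^sup>+u. ennreal (frechet_of (u $ j) powr p) \<partial>M) \<noteq> \<infinity>"
proof -
  have bound: "ennreal (frechet_of s powr p) * indicator {0..1} s
      \<le> ennreal (indicat_real {0..1} (1 - s) * (1 - s) powr (- p))" for s
  proof (cases "0 < s \<and> s < 1")
    case True
    have "1 / (- ln s) \<le> 1 / (1 - s)"
      using True ln_le_minus_one[of s] by (intro divide_left_mono mult_pos_pos) auto
    then have "frechet_of s \<le> 1 / (1 - s)"
      using True by (simp add: frechet_of_def)
    then have "frechet_of s powr p \<le> (1 / (1 - s)) powr p"
      using assms frechet_of_nonneg by (intro powr_mono2) auto
    also have "\<dots> = (1 - s) powr (- p)"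
      using True by (simp add: powr_divide powr_minus_divide)
    finally show ?thesis using True by (auto simp: indicator_def intro!: ennreal_leI)
  qed (auto simp: frechet_of_def)
  have "(\<integral>\<^sup>+u. ennreal (frechet_of (u $ j) powr p) \<partial>M)
      = (\<integral>\<^sup>+s. ennreal (frechet_of s powr p) \<partial>distr M borel (\<lambda>x. x $ j))"
    by (subst nn_integral_distr) auto
  also have "\<dots> = (\<integral>\<^sup>+s. ennreal (frechet_of s powr p) * indicator {0..1} s \<partial>lborel)"
    by (simp add: distr_component nn_integral_uniform_measure divide_ennreal_def)
  also have "\<dots> \<le> (\<integral>\<^sup>+s. ennreal (indicat_real {0..1} (1 - s) * (1 - s) powr (- p)) \<partial>lborel)"
    by (intro nn_integral_mono bound)
  also have "\<dots> = (\<integral>\<^sup>+s. ennreal (indicat_real {0..1} s * s powr (- p)) \<partial>lborel)"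
    by (subst (2) nn_integral_real_affine[where c = "-1" and t = 1]) auto
  also have "\<dots> = ennreal (1 powr (- p + 1) / (- p + 1))"
    by (intro nn_integral_has_integral_lebesgue has_integral_powr_from_0) (use assms in auto)
  also have "\<dots> < \<infinity>" by simp
  finally show ?thesis by simp
qed

end

text \<open>
  The properties of a stable tail dependence function from which everything else about \<open>L\<close> follows.
\<close>

locale stable_tail =
  fixes L :: "real ^ 'n \<Rightarrow> real"
  assumes mono: "\<lbrakk>0 \<le> x; x \<le> y\<rbrakk> \<Longrightarrow> L x \<le> L y"
    and scale: "\<lbrakk>0 \<le> x; 0 < c\<rbrakk> \<Longrightarrow> L (c *\<^sub>R x) = c * L x"
    and subadd: "\<lbrakk>0 \<le> x; 0 \<le> y\<rbrakk> \<Longrightarrow> L (x + y) \<le> L x + L y"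
    and axis: "L (axis i 1) = 1"

lemma extreme_value_copula_exp:
  assumes "stable_tail_dependence Cinf L" "0 \<le> x"
  shows "Cinf (vexp (- x)) = exp (- L x)"
proof -
  have "vexp (- x) \<in> {0..1}" "\<forall>i. 0 < vexp (- x) $ i"
    using assms(2) by (auto simp: less_eq_vec_def vexp_def)
  moreover have "(\<chi> i. - ln (vexp (- x) $ i)) = x"
    by (simp add: vexp_def vec_eq_iff)
  ultimately show ?thesis
    using assms(1) unfolding stable_tail_dependence_def by auto
qed

lemma vpowr_vexp: "vpowr (vexp x) s = vexp (s *\<^sub>R x)"
  by (simp add: vpowr_def vexp_def vec_eq_iff powr_def)

text \<open>
  Subadditivity goes back to the random vector behind \<open>Cinf\<close>. The law of \<open>weighted_max x\<close> depends on
  \<open>x\<close> through \<open>L x\<close> alone, so it agrees with that of \<open>L x\<close> times a single Frechet variable;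
  comparing fractional moments transfers the subadditivity of \<open>weighted_max\<close> to \<open>L\<close>.
\<close>

lemma stable_tail_dependence_imp_stable_tail:
  fixes L :: "real ^ 'n \<Rightarrow> real"
  assumes evc: "extreme_value_copula Cinf" and std: "stable_tail_dependence Cinf L"
  shows "stable_tail L"
proof -
  have cop: "copula Cinf" using evc by (simp add: extreme_value_copula_def)
  note ex = extreme_value_copula_exp[OF std]
  have mono: "L x \<le> L y" if "0 \<le> x" "x \<le> y" for x y
  proof -
    have "Cinf (vexp (- y)) \<le> Cinf (vexp (- x))"
      using that by (intro copula_mono[OF cop]) (auto simp: less_eq_vec_def vexp_def)
    then show ?thesis using ex that order_trans[OF that] by simp
  qed
  have scale_inv: "L ((1 / r) *\<^sub>R x) * r = L x" if "0 \<le> x" "0 < r" for x r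
  proof -
    have "vexp (- x) \<in> {0..1}"
      using that(1) by (auto simp: less_eq_vec_def vexp_def)
    then have "Cinf (vpowr (vexp (- x)) (1 / r)) powr r = Cinf (vexp (- x))"
      using evc that(2) by (auto simp: extreme_value_copula_def)
    moreover have "vpowr (vexp (- x)) (1 / r) = vexp (- ((1 / r) *\<^sub>R x))"
      by (simp add: vpowr_vexp)
    moreover have "0 \<le> (1 / r) *\<^sub>R x" using that by (simp add: less_eq_vec_def)
    ultimately show ?thesis using ex[of "(1 / r) *\<^sub>R x"] ex[of x] that(1)
      by (simp add: powr_def mult.commute)
  qed
  have scale: "L (c *\<^sub>R x) = c * L x" if "0 \<le> x" "0 < c" for x c
    using scale_inv[of x "1 / c"] that by (simp add: field_simps)
  have ge: "x $ i \<le> L x" if "0 \<le> x" for x i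
  proof -
    have "Cinf (vexp (- x)) \<le> vexp (- x) $ i"
      by (rule copula_le_component[OF cop]) (simp add: vexp_def)
    then show ?thesis using ex[OF that] by (simp add: vexp_def)
  qed
  have axis: "L (axis i 1) = 1" for i
  proof (rule antisym)
    have pos: "0 \<le> (axis i 1 :: real ^ 'n)" by (simp add: less_eq_vec_def axis_def)
    show "1 \<le> L (axis i 1)" using ge[OF pos, of i] by (simp add: axis_def)
    have "1 \<le> Cinf (vexp (- axis i 1)) + (\<Sum>j\<in>UNIV. \<bar>(1 :: real ^ 'n) $ j - vexp (- axis i 1) $ j\<bar>)"
      using copula_le_plus[OF cop, of 1 "vexp (- axis i 1)"] copula_one[OF cop] by simp
    also have "(\<Sum>j\<in>UNIV. \<bar>(1 :: real ^ 'n) $ j - vexp (- axis i 1) $ j\<bar>)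
        = (\<Sum>j\<in>UNIV. if j = i then 1 - exp (- 1) else 0)"
      by (intro sum.cong) (auto simp: vexp_def axis_def)
    finally have "exp (- 1) \<le> exp (- L (axis i 1))" using ex[OF pos] by simp
    then show "L (axis i 1) \<le> 1" by simp
  qed
  have L0: "L 0 = 0" using scale[of 0 2] by simp
  have pos: "0 < L x" if x: "0 \<le> x" "x \<noteq> 0" for x
  proof -
    obtain i where "x $ i \<noteq> 0" using x(2) by (auto simp: vec_eq_iff)
    then have "0 < x $ i" using x(1) by (simp add: less_eq_vec_def order_le_less) metis
    then show ?thesis using ge[OF x(1), of i] by simp
  qed
  have subadd: "L (x + y) \<le> L x + L y" if xy: "0 \<le> x" "0 \<le> y" for x y
  proof (cases "x = 0 \<or> y = 0")
    case True
    then show ?thesis using L0 by auto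
  next
    case False
    obtain M where M: "uniform_margins M" and C: "\<And>x. Cinf x = measure M {..x}"
      using copula_vector[OF cop] by blast
    interpret uniform_margins M by fact
    have cdf_wm: "cdf (distr M borel (weighted_max z)) t = (if 0 < t then exp (- L z / t) else 0)"
      if "0 \<le> z" "z \<noteq> 0" for z t
    proof -
      have eq: "cdf (distr M borel (weighted_max z)) t = prob {u \<in> space M. weighted_max z u \<le> t}" for t
        by (simp add: cdf_def measure_distr vimage_def Int_def conj_commute)
      have t_pos: "prob {u \<in> space M. weighted_max z u \<le> t} = exp (- L z / t)" if "0 < t" for t
      proof -
        have "0 \<le> z /\<^sub>R t" using \<open>0 \<le> z\<close> \<open>0 < t\<close> by (simp add: less_eq_vec_def)
        then have "prob {u \<in> space M. weighted_max z u \<le> t} = exp (- L (z /\<^sub>R t))"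
          using prob_weighted_max_le[OF \<open>0 < t\<close>, of z] C[of "vexp (- (z /\<^sub>R t))"] ex[of "z /\<^sub>R t"] by simp
        then show ?thesis using scale[OF \<open>0 \<le> z\<close>, of "inverse t"] \<open>0 < t\<close> by (simp add: field_simps)
      qed
      have "prob {u \<in> space M. weighted_max z u \<le> t} = 0" if "t \<le> 0"
      proof -
        \<comment> \<open>the bound \<open>exp (- L z / s)\<close> vanishes as \<open>s\<close> decreases to 0\<close>
        have "\<forall>\<^sub>F s in at_right 0. prob {u \<in> space M. weighted_max z u \<le> t} \<le> exp (- L z / s)"
        proof (rule eventually_at_rightI[of 0 1])
          fix s :: real assume "s \<in> {0<..<1}"
          then have "prob {u \<in> space M. weighted_max z u \<le> t} \<le> prob {u \<in> space M. weighted_max z u \<le> s}"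
            using that by (intro finite_measure_mono) auto
          then show "prob {u \<in> space M. weighted_max z u \<le> t} \<le> exp (- L z / s)"
            using t_pos[of s] \<open>s \<in> {0<..<1}\<close> by simp
        qed simp
        moreover have "((\<lambda>s. exp (- L z / s)) \<longlongrightarrow> 0) (at_right 0)"
        proof -
          have "filterlim (\<lambda>s. - L z * inverse s) at_bot (at_right 0)"
            by (rule filterlim_tendsto_neg_mult_at_bot[OF tendsto_const _ filterlim_inverse_at_top_right])
              (use pos[OF \<open>0 \<le> z\<close> \<open>z \<noteq> 0\<close>] in simp)
          then show ?thesis
            using filterlim_compose[OF exp_at_bot] by (simp add: divide_inverse)
        qed
        ultimately have "prob {u \<in> space M. weighted_max z u \<le> t} \<le> 0"
          by (intro tendsto_lowerbound) auto
        then show ?thesis using measure_nonneg[of M] by (metis antisym)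
      qed
      then show ?thesis using eq t_pos by auto
    qed
    have moment: "(\<integral>\<^sup>+u. ennreal (weighted_max z u powr p) \<partial>M)
        = ennreal (L z powr p) * (\<integral>\<^sup>+u. ennreal (frechet_of (u $ j) powr p) \<partial>M)"
      if z: "0 \<le> z" "z \<noteq> 0" for z p j
    proof -
      \<comment> \<open>a point on an axis with the same value of \<open>L\<close>, hence the same law\<close>
      let ?y = "L z *\<^sub>R axis j 1 :: real ^ 'n"
      have y: "0 \<le> ?y" "?y \<noteq> 0" and Ly: "L ?y = L z"
        using pos[OF z] scale[of "axis j 1" "L z"] axis[of j]
        by (auto simp: less_eq_vec_def axis_def vec_eq_iff)
      have "distr M borel (weighted_max z) = distr M borel (weighted_max ?y)"
        by (rule cdf_unique)
          (auto simp: cdf_wm[OF z] cdf_wm[OF y] Ly fun_eq_iff intro!: real_distribution_distr)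
      then have "(\<integral>\<^sup>+s. ennreal (s powr p) \<partial>distr M borel (weighted_max z))
          = (\<integral>\<^sup>+s. ennreal (s powr p) \<partial>distr M borel (weighted_max ?y))"
        by simp
      then have "(\<integral>\<^sup>+u. ennreal (weighted_max z u powr p) \<partial>M)
          = (\<integral>\<^sup>+u. ennreal (weighted_max ?y u powr p) \<partial>M)"
        by (simp add: nn_integral_distr)
      also have "\<dots> = (\<integral>\<^sup>+u. ennreal (L z powr p) * ennreal (frechet_of (u $ j) powr p) \<partial>M)"
        using pos[OF z] by (intro nn_integral_cong)
          (simp add: weighted_max_axis powr_mult frechet_of_nonneg ennreal_mult)
      finally show ?thesis by (simp add: nn_integral_cmult)
    qed
    have xy': "0 \<le> x + y" "x + y \<noteq> 0" "x \<noteq> 0" "y \<noteq> 0"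
      using xy False by (auto simp: add_nonneg_eq_0_iff)
    have le: "L (x + y) powr p \<le> L x powr p + L y powr p" if p: "0 < p" "p < 1" for p
    proof -
      fix j :: 'n
      define m where "m = (\<integral>\<^sup>+u. ennreal (frechet_of (u $ j) powr p) \<partial>M)"
      have m: "m \<noteq> 0" "m \<noteq> \<infinity>"
        using frechet_moment_pos[OF p(1), of j] frechet_moment_finite[OF p, of j] by (auto simp: m_def)
      have "ennreal (L (x + y) powr p) * m = (\<integral>\<^sup>+u. ennreal (weighted_max (x + y) u powr p) \<partial>M)"
        using moment[OF xy'(1,2)] by (simp add: m_def)
      also have "\<dots> \<le> (\<integral>\<^sup>+u. ennreal (weighted_max x u powr p) + ennreal (weighted_max y u powr p) \<partial>M)"
      proof (intro nn_integral_mono)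
        fix u
        have "weighted_max (x + y) u powr p \<le> (weighted_max x u + weighted_max y u) powr p"
          using p by (intro powr_mono2 weighted_max_nonneg weighted_max_add_le xy') auto
        also have "\<dots> \<le> weighted_max x u powr p + weighted_max y u powr p"
          using p by (intro powr_add_le_add_powr weighted_max_nonneg xy) auto
        finally show "ennreal (weighted_max (x + y) u powr p)
            \<le> ennreal (weighted_max x u powr p) + ennreal (weighted_max y u powr p)"
          by (simp flip: ennreal_plus)
      qed
      also have "\<dots> = ennreal (L x powr p) * m + ennreal (L y powr p) * m"
        using moment[OF xy(1) xy'(3)] moment[OF xy(2) xy'(4)]
        by (simp add: nn_integral_add m_def)
      finally have "m * ennreal (L (x + y) powr p) \<le> m * ennreal (L x powr p + L y powr p)"
        by (simp add: ennreal_plus distrib_left mult.commute)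
      then show ?thesis
        using m by (simp add: ennreal_mult_le_mult_iff flip: ennreal_plus)
    qed
    \<comment> \<open>let the exponent \<open>p\<close> increase to 1\<close>
    have lim: "((\<lambda>p. c powr p) \<longlongrightarrow> c) (at_left 1)" if "0 < c" for c :: real
      using tendsto_powr[OF tendsto_const tendsto_ident_at, of c 1 "{..<1}"] that by simp
    show ?thesis
    proof (rule tendsto_le)
      show "((\<lambda>p. L (x + y) powr p) \<longlongrightarrow> L (x + y)) (at_left 1)"
        "((\<lambda>p. L x powr p + L y powr p) \<longlongrightarrow> L x + L y) (at_left 1)"
        using pos xy xy' by (auto intro!: tendsto_add lim)
      show "\<forall>\<^sub>F p in at_left 1. L (x + y) powr p \<le> L x powr p + L y powr p"
        by (rule eventually_at_leftI[of 0]) (auto intro: le)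
    qed simp
  qed
  show ?thesis by unfold_locales (fact mono scale subadd axis)+
qed

section \<open>Uniform convergence\<close>

lemma uniform_limit_of_tendsto:
  "(c \<longlongrightarrow> l) F \<Longrightarrow> uniform_limit X (\<lambda>n x. c n) (\<lambda>x. l) F"
  by (auto simp: uniform_limit_iff tendsto_iff elim!: eventually_mono)

lemma uniform_limit_cmult:
  fixes f :: "'a \<Rightarrow> 'b \<Rightarrow> real"
  assumes "(c \<longlongrightarrow> a) F" "uniform_limit X f l F" "bounded (l ` X)"
  shows "uniform_limit X (\<lambda>n x. c n * f n x) (\<lambda>x. a * l x) F"
  using uniform_lim_mult[OF uniform_limit_of_tendsto[OF assms(1)] assms(2)] assms(3)
  by (auto simp: image_constant_conv)

text \<open>
  Both the functions and the points at which they are evaluated vary with the index; uniform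
  continuity of the limit controls the displacement of the points.
\<close>

lemma uniform_limit_compose_moving:
  fixes f :: "'a \<Rightarrow> 'b::metric_space \<Rightarrow> 'c::metric_space"
  assumes f: "uniform_limit X f l F" and l: "uniformly_continuous_on X l"
    and g: "uniform_limit K g h F" and ev: "\<forall>\<^sub>F n in F. g n ` K \<subseteq> X" and h: "h ` K \<subseteq> X"
  shows "uniform_limit K (\<lambda>n x. f n (g n x)) (\<lambda>x. l (h x)) F"
proof (rule uniform_limitI)
  fix e :: real assume "0 < e"
  then have e: "0 < e / 2" by simp
  have "uniform_limit K (\<lambda>n x. l (g n x)) (l \<circ> h) F"
    by (rule uniform_limit_compose[OF g l ev h])
  from uniform_limitD[OF this e] uniform_limitD[OF f e] ev
  show "\<forall>\<^sub>F n in F. \<forall>x\<in>K. dist (f n (g n x)) (l (h x)) < e"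
  proof eventually_elim
    case (elim n)
    show ?case
    proof
      fix x assume x: "x \<in> K"
      then have "dist (f n (g n x)) (l (g n x)) < e / 2" "dist (l (g n x)) (l (h x)) < e / 2"
        using elim by auto
      then show "dist (f n (g n x)) (l (h x)) < e"
        by (metis dist_triangle_half_l dist_commute)
    qed
  qed
qed

text \<open>
  Dini's theorem along the real half-line. If uniformity fails, there are points \<open>X n\<close> with gap at least
  \<open>e\<close> at index \<open>n\<close>, hence at every smaller index. At an accumulation point the gap is then at least
  \<open>e\<close> for every index, against pointwise convergence.
\<close>

lemma uniform_limit_decreasing:
  fixes f :: "real \<Rightarrow> 'a::metric_space \<Rightarrow> real"
  assumes K: "compact K" and cont: "\<And>r. c \<le> r \<Longrightarrow> continuous_on K (f r)" "continuous_on K g"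
    and decr: "\<And>r s x. \<lbrakk>x \<in> K; c \<le> r; r \<le> s\<rbrakk> \<Longrightarrow> f s x \<le> f r x"
    and lim: "\<And>x. x \<in> K \<Longrightarrow> ((\<lambda>r. f r x) \<longlongrightarrow> g x) at_top"
  shows "uniform_limit K f g at_top"
proof (rule ccontr)
  have ge: "g x \<le> f r x" if "x \<in> K" "c \<le> r" for x r
    by (rule tendsto_upperbound[OF lim[OF that(1)]])
      (use that decr in \<open>auto intro!: eventually_at_top_linorderI[of r]\<close>)
  assume "\<not> uniform_limit K f g at_top"
  then obtain e where e: "0 < e" "\<not> (\<forall>\<^sub>F r in at_top. \<forall>x\<in>K. dist (f r x) (g x) < e)"
    by (auto simp: uniform_limit_iff)
  have "\<exists>x\<in>K. e \<le> f (max c (real n)) x - g x" for n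
  proof -
    obtain r x where r: "max c (real n) \<le> r" "x \<in> K" "\<not> dist (f r x) (g x) < e"
      using e(2) unfolding eventually_at_top_linorder by blast
    then have "e \<le> f r x - g x" using ge[of x r] by (simp add: dist_real_def)
    moreover have "f r x \<le> f (max c (real n)) x" using r by (intro decr) auto
    ultimately show ?thesis using r(2) by (intro bexI[of _ x]) auto
  qed
  then obtain X where X: "\<And>n. X n \<in> K" "\<And>n. e \<le> f (max c (real n)) (X n) - g (X n)"
    by metis
  obtain l s where l: "l \<in> K" and s: "strict_mono s" "(X \<circ> s) \<longlonglongrightarrow> l"
    using K X(1) unfolding compact_def by metis
  have gap: "e \<le> f r l - g l" if r: "c \<le> r" for r
  proof (rule tendsto_lowerbound)
    have "continuous_on K (\<lambda>x. f r x - g x)" by (intro continuous_on_diff cont r)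
    from continuous_on_tendsto_compose[OF this s(2) l]
    show "(\<lambda>n. f r ((X \<circ> s) n) - g ((X \<circ> s) n)) \<longlonglongrightarrow> f r l - g l"
      using X(1) by simp
    have "e \<le> f r (X (s n)) - g (X (s n))" if "nat \<lceil>r\<rceil> \<le> n" for n
    proof -
      have "r \<le> real (s n)" using that seq_suble[OF s(1), of n] by linarith
      then have "f (max c (real (s n))) (X (s n)) \<le> f r (X (s n))"
        using r X(1) by (intro decr) auto
      then show ?thesis using X(2)[of "s n"] by simp
    qed
    then show "\<forall>\<^sub>F n in sequentially. e \<le> f r ((X \<circ> s) n) - g ((X \<circ> s) n)"
      by (auto intro: eventually_sequentiallyI[of "nat \<lceil>r\<rceil>"])
  qed simp
  have "((\<lambda>r. f r l - g l) \<longlongrightarrow> g l - g l) at_top"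
    by (intro tendsto_diff lim l tendsto_const)
  then have "e \<le> g l - g l"
    by (rule tendsto_lowerbound) (auto intro!: eventually_at_top_linorderI[of c] gap)
  then show False using e(1) by simp
qed

lemma continuous_on_l1:
  fixes f :: "real ^ 'n \<Rightarrow> real"
  assumes "\<And>x y. \<lbrakk>x \<in> X; y \<in> X\<rbrakk> \<Longrightarrow> f x \<le> f y + (\<Sum>i\<in>UNIV. \<bar>x $ i - y $ i\<bar>)"
  shows "continuous_on X f"
proof -
  have "CARD('n)-lipschitz_on X f"
  proof (rule lipschitz_onI)
    fix x y assume xy: "x \<in> X" "y \<in> X"
    have "(\<Sum>i\<in>UNIV. \<bar>x $ i - y $ i\<bar>) \<le> (\<Sum>i\<in>(UNIV :: 'n set). dist x y)"
      using component_le_norm_cart[of "x - y"] by (intro sum_mono) (simp add: dist_norm)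
    moreover have "\<bar>f x - f y\<bar> \<le> (\<Sum>i\<in>UNIV. \<bar>x $ i - y $ i\<bar>)"
      using assms[OF xy] assms[OF xy(2,1)] by (simp add: abs_minus_commute)
    ultimately show "dist (f x) (f y) \<le> CARD('n) * dist x y"
      by (simp add: dist_real_def)
  qed simp
  then show ?thesis by (rule lipschitz_on_continuous_on)
qed

lemma compact_Icc_vec [simp]: "compact {a..b :: real ^ 'n}"
  by (simp add: interval_cbox_cart)

lemma component_less_norm_plus_1: "(x :: real ^ 'n) $ i < norm x + 1"
  using component_le_norm_cart[of x i] by linarith

lemma in_Icc_norm: "0 \<le> (x :: real ^ 'n) \<Longrightarrow> x \<in> {0..vec (norm x + 1)}"
  using component_less_norm_plus_1[of x] by (auto simp: less_eq_vec_def less_imp_le)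

text \<open>
  Every point has a relative neighbourhood inside some box \<open>{0..vec T}\<close>.
\<close>

lemma continuous_on_nonneg_vecI:
  fixes f :: "real ^ 'n \<Rightarrow> real"
  assumes "\<And>T. 0 < T \<Longrightarrow> continuous_on {0..vec T} f"
  shows "continuous_on {0..} f"
  unfolding continuous_on_eq_continuous_within
proof
  fix x :: "real ^ 'n" assume x: "x \<in> {0..}"
  define T where "T = norm x + 1"
  let ?U = "{y :: real ^ 'n. \<forall>i. y $ i < T}"
  have "open ?U"
  proof -
    have "?U = (\<Inter>i. {y. y $ i < T})" by auto
    then show ?thesis
      by (auto intro!: open_INT open_Collect_less continuous_intros)
  qed
  moreover have "x \<in> ?U"
    by (simp add: T_def component_less_norm_plus_1)
  moreover have "?U \<inter> {0..} - {x} = ?U \<inter> {0..vec T} - {x}"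
    by (auto simp: less_eq_vec_def) (meson less_imp_le)
  ultimately have "at x within {0..} = at x within {0..vec T}"
    by (intro at_within_nhd[of x ?U]) auto
  moreover have "x \<in> {0..vec T}" "0 < T"
    using x in_Icc_norm[of x] by (auto simp: T_def add_nonneg_pos)
  ultimately show "continuous (at x within {0..}) f"
    using assms[of T] by (auto simp: continuous_on_eq_continuous_within)
qed

text \<open>
  The mean value theorem writes the new quotient as \<open>h'(z)\<close> times the old one, with \<open>z\<close> between
  \<open>f r x\<close> and \<open>g x\<close>, and \<open>f r\<close> tends to \<open>g\<close> uniformly because \<open>\<alpha>\<close> tends to 0. The margin \<open>d\<close> keeps
  \<open>f r x\<close> in the interval.
\<close>

lemma uniform_limit_difference_quotient:
  fixes h h' :: "real \<Rightarrow> real" and f :: "'a \<Rightarrow> 'b \<Rightarrow> real"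
  assumes Q: "uniform_limit K (\<lambda>r x. (f r x - g x) / \<alpha> r) S F"
    and \<alpha>: "(\<alpha> \<longlongrightarrow> 0) F" "\<forall>\<^sub>F r in F. \<alpha> r \<noteq> 0"
    and S: "bounded (S ` K)" and g: "g ` K \<subseteq> {lo + d..hi - d}" and d: "0 < d"
    and h: "\<And>v. v \<in> {lo..hi} \<Longrightarrow> (h has_real_derivative h' v) (at v)"
    and h': "continuous_on {lo..hi} h'"
  shows "uniform_limit K (\<lambda>r x. (h (f r x) - h (g x)) / \<alpha> r) (\<lambda>x. h' (g x) * S x) F"
proof -
  have f_lim: "uniform_limit K f g F"
  proof -
    from uniform_limit_cmult[OF \<alpha>(1) Q S]
    have "uniform_limit K (\<lambda>r x. g x + \<alpha> r * ((f r x - g x) / \<alpha> r)) (\<lambda>x. g x + 0) F"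
      by (intro uniform_limit_add uniform_limit_const) simp
    moreover have "\<forall>\<^sub>F r in F. \<forall>x\<in>K. g x + \<alpha> r * ((f r x - g x) / \<alpha> r) = f r x"
      using \<alpha>(2) by eventually_elim simp
    ultimately show ?thesis by (subst (asm) uniform_limit_cong) auto
  qed
  have "\<exists>z. \<bar>z - q\<bar> \<le> \<bar>p - q\<bar> \<and> z \<in> {lo..hi} \<and> h p - h q = h' z * (p - q)"
    if pq: "p \<in> {lo..hi}" "q \<in> {lo..hi}" for p q
  proof (cases p q rule: linorder_cases)
    case less
    then obtain z where "p < z" "z < q" "h q - h p = (q - p) * h' z"
      using MVT2[of p q h h'] h pq by auto
    then show ?thesis using pq by (intro exI[of _ z]) (auto simp: algebra_simps)
  next
    case greater
    then obtain z where "q < z" "z < p" "h p - h q = (p - q) * h' z"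
      using MVT2[of q p h h'] h pq by auto
    then show ?thesis using pq by (intro exI[of _ z]) (auto simp: algebra_simps)
  qed (use pq in auto)
  then obtain Z where Z: "\<And>p q. \<lbrakk>p \<in> {lo..hi}; q \<in> {lo..hi}\<rbrakk> \<Longrightarrow>
      \<bar>Z p q - q\<bar> \<le> \<bar>p - q\<bar> \<and> Z p q \<in> {lo..hi} \<and> h p - h q = h' (Z p q) * (p - q)"
    by metis
  have Z_near: "\<bar>Z p q - q\<bar> \<le> \<bar>p - q\<bar>" and Z_in: "Z p q \<in> {lo..hi}"
    and Z_eq: "h p - h q = h' (Z p q) * (p - q)" if "p \<in> {lo..hi}" "q \<in> {lo..hi}" for p q
    using Z[OF that] by blast+
  have f_in: "\<forall>\<^sub>F r in F. \<forall>x\<in>K. f r x \<in> {lo..hi} \<and> g x \<in> {lo..hi}"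
    using uniform_limitD[OF f_lim d]
  proof eventually_elim
    case (elim r)
    show ?case
    proof
      fix x assume x: "x \<in> K"
      then have "dist (f r x) (g x) < d" "g x \<in> {lo + d..hi - d}" using elim g by auto
      then show "f r x \<in> {lo..hi} \<and> g x \<in> {lo..hi}" using d by (auto simp: dist_real_def)
    qed
  qed
  have Z_lim: "uniform_limit K (\<lambda>r x. Z (f r x) (g x)) g F"
  proof (rule uniform_limitI)
    fix e :: real assume "0 < e"
    from uniform_limitD[OF f_lim this] f_in
    show "\<forall>\<^sub>F r in F. \<forall>x\<in>K. dist (Z (f r x) (g x)) (g x) < e"
    proof eventually_elim
      case (elim r)
      show ?case
      proof
        fix x assume x: "x \<in> K"
        then have "\<bar>Z (f r x) (g x) - g x\<bar> \<le> \<bar>f r x - g x\<bar>" using elim(2) by (intro Z_near) auto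
        also have "\<dots> < e" using elim(1) x by (simp add: dist_real_def)
        finally show "dist (Z (f r x) (g x)) (g x) < e" by (simp add: dist_real_def)
      qed
    qed
  qed
  have gK: "g ` K \<subseteq> {lo..hi}" using g d by force
  have uc: "uniformly_continuous_on {lo..hi} h'"
    by (rule compact_uniformly_continuous[OF h']) simp
  have "\<forall>\<^sub>F r in F. (\<lambda>x. Z (f r x) (g x)) ` K \<subseteq> {lo..hi}"
    using f_in by eventually_elim (intro image_subsetI Z_in, blast+)
  from uniform_limit_compose[OF Z_lim uc this gK]
  have "uniform_limit K (\<lambda>r x. h' (Z (f r x) (g x))) (\<lambda>x. h' (g x)) F" by (simp add: comp_def)
  moreover have "bounded ((\<lambda>x. h' (g x)) ` K)"
  proof (rule bounded_subset)
    show "bounded (h' ` {lo..hi})" by (intro compact_imp_bounded compact_continuous_image h') simp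
  qed (use gK in auto)
  ultimately have "uniform_limit K (\<lambda>r x. h' (Z (f r x) (g x)) * ((f r x - g x) / \<alpha> r)) (\<lambda>x. h' (g x) * S x) F"
    using Q S by (intro uniform_lim_mult)
  moreover have "\<forall>\<^sub>F r in F. \<forall>x\<in>K. h' (Z (f r x) (g x)) * ((f r x - g x) / \<alpha> r) = (h (f r x) - h (g x)) / \<alpha> r"
    using f_in
  proof eventually_elim
    case (elim r)
    show ?case
    proof
      fix x assume "x \<in> K"
      then have "h (f r x) - h (g x) = h' (Z (f r x) (g x)) * (f r x - g x)"
        using elim by (intro Z_eq) auto
      then show "h' (Z (f r x) (g x)) * ((f r x - g x) / \<alpha> r) = (h (f r x) - h (g x)) / \<alpha> r"
        by simp
    qed
  qed
  ultimately show ?thesis by (subst (asm) uniform_limit_cong) auto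
qed

text \<open>
  Where \<open>S\<close> does not vanish, the two limits determine \<open>lim 2 r \<alpha> r\<close>, a finite number \<open>c\<close>. Hence
  \<open>g = c S\<close>, and \<open>S\<close> is continuous.
\<close>

lemma pointwise_limit_continuous_of_uniform_ratio:
  fixes Q :: "real \<Rightarrow> real ^ 'n \<Rightarrow> real"
  assumes Q: "\<And>T. 0 < T \<Longrightarrow> uniform_limit {0..vec T} (\<lambda>r x. Q r x / \<alpha> r) S at_top"
    and S: "\<And>T. 0 < T \<Longrightarrow> continuous_on {0..vec T} S"
    and \<alpha>: "\<And>r. 0 < r \<Longrightarrow> 0 < \<alpha> r" and x0: "0 \<le> x0" "S x0 \<noteq> 0"
    and g: "\<And>x. 0 \<le> x \<Longrightarrow> ((\<lambda>r. 2 * r * Q r x) \<longlongrightarrow> g x) at_top"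
  shows "continuous_on {0..} g"
proof -
  have ptw: "((\<lambda>r. Q r x / \<alpha> r) \<longlongrightarrow> S x) at_top" if "0 \<le> x" for x
    by (rule tendsto_uniform_limitI[OF Q in_Icc_norm[OF that]]) (simp add: add_nonneg_pos)
  define c where "c = g x0 / S x0"
  have "((\<lambda>r. 2 * r * Q r x0 / (Q r x0 / \<alpha> r)) \<longlongrightarrow> c) at_top"
    unfolding c_def by (intro tendsto_divide g ptw x0)
  moreover have "\<forall>\<^sub>F r in at_top. 2 * r * Q r x0 / (Q r x0 / \<alpha> r) = 2 * r * \<alpha> r"
    using tendsto_imp_eventually_ne[OF ptw[OF x0(1)] x0(2)] eventually_gt_at_top[of 0]
    by eventually_elim auto
  ultimately have c: "((\<lambda>r. 2 * r * \<alpha> r) \<longlongrightarrow> c) at_top" by (rule Lim_transform_eventually)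
  have "g x = c * S x" if x: "0 \<le> x" for x
  proof -
    have "((\<lambda>r. 2 * r * \<alpha> r * (Q r x / \<alpha> r)) \<longlongrightarrow> c * S x) at_top"
      by (intro tendsto_mult c ptw x)
    moreover have "\<forall>\<^sub>F r in at_top. 2 * r * \<alpha> r * (Q r x / \<alpha> r) = 2 * r * Q r x"
      using eventually_gt_at_top[of 0] by eventually_elim (use \<alpha> in \<open>auto simp: less_imp_neq[symmetric]\<close>)
    ultimately have "((\<lambda>r. 2 * r * Q r x) \<longlongrightarrow> c * S x) at_top" by (rule Lim_transform_eventually)
    then show ?thesis using tendsto_unique[OF _ g[OF x]] by simp
  qed
  moreover have "continuous_on {0..} (\<lambda>x. c * S x)"
    by (intro continuous_on_mult continuous_on_const continuous_on_nonneg_vecI S)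
  ultimately show ?thesis by (subst continuous_on_cong[OF refl]) auto
qed

section \<open>Slopes of the stable tail dependence function\<close>

text \<open>
  For \<open>\<sigma> = 1\<close> this is the difference quotient defining \<open>Gamma1\<close>, for \<open>\<sigma> = -1\<close> the negative of the
  one defining \<open>Gamma2\<close>. With this sign both decrease in \<open>r\<close>.
\<close>

definition square_slope :: "(real ^ 'n \<Rightarrow> real) \<Rightarrow> real \<Rightarrow> real \<Rightarrow> real ^ 'n \<Rightarrow> real" where
  "square_slope L \<sigma> r x = r * (L (x + (\<sigma> / r) *\<^sub>R x\<^sup>2) - L x)"

lemma scaleR_vec_nonneg: "\<lbrakk>0 \<le> a; 0 \<le> (x :: real ^ 'n)\<rbrakk> \<Longrightarrow> 0 \<le> a *\<^sub>R x"
  by (simp add: less_eq_vec_def)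

text \<open>
  For \<open>r \<ge> T\<close> the shifted point stays in the nonnegative orthant, the only place where \<open>L\<close> is known.
\<close>

lemma square_shift_nonneg:
  fixes x :: "real ^ 'n"
  assumes "x \<in> {0..vec T}" "\<bar>\<sigma>\<bar> \<le> 1" "T \<le> r" "0 < r"
  shows "0 \<le> x + (\<sigma> / r) *\<^sub>R x\<^sup>2"
  unfolding less_eq_vec_def
proof
  fix i
  have x: "0 \<le> x $ i" "x $ i \<le> r" using assms by (auto simp: less_eq_vec_def intro: order_trans)
  have "\<bar>\<sigma> * (x $ i)\<bar> \<le> 1 * r"
    unfolding abs_mult using assms x by (intro mult_mono) auto
  then have "0 \<le> 1 + \<sigma> * x $ i / r" using assms(4) by (simp add: field_simps)
  then have "0 \<le> x $ i * (1 + \<sigma> * x $ i / r)" using x by simp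
  then show "0 $ i \<le> (x + (\<sigma> / r) *\<^sub>R x\<^sup>2) $ i"
    by (simp add: power2_vec_component power2_eq_square algebra_simps)
qed

context stable_tail
begin

lemma zero: "L 0 = 0"
  using scale[of 0 2] by simp

lemma nonneg: "0 \<le> x \<Longrightarrow> 0 \<le> L x"
  using mono[of 0 x] zero by simp

lemma le_sum:
  assumes "0 \<le> x"
  shows "L x \<le> (\<Sum>i\<in>UNIV. x $ i)"
proof -
  have part: "L (\<Sum>i\<in>I. x $ i *\<^sub>R axis i 1) \<le> (\<Sum>i\<in>I. x $ i)" if "finite I" for I
    using that
  proof induction
    case (insert i I)
    have pos: "0 \<le> x $ j *\<^sub>R (axis j 1 :: real ^ 'n)" for j
      using assms by (simp add: less_eq_vec_def axis_def)
    have "L (x $ i *\<^sub>R axis i 1) = x $ i"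
    proof (cases "x $ i = 0")
      case False
      then have "0 < x $ i" using assms by (simp add: less_eq_vec_def order_le_less) metis
      then show ?thesis using scale[of "axis i 1" "x $ i"] axis by (simp add: less_eq_vec_def axis_def)
    qed (simp add: zero)
    moreover have "L (x $ i *\<^sub>R axis i 1 + (\<Sum>j\<in>I. x $ j *\<^sub>R axis j 1))
        \<le> L (x $ i *\<^sub>R axis i 1) + L (\<Sum>j\<in>I. x $ j *\<^sub>R axis j 1)"
      by (intro subadd pos sum_nonneg)
    ultimately show ?case using insert by simp
  qed (simp add: zero)
  have "(\<Sum>i\<in>UNIV. x $ i *\<^sub>R axis i 1) = x"
    using basis_expansion[of x] by (simp add: scalar_mult_eq_scaleR)
  then show ?thesis using part[of UNIV] by simp
qed

lemma le_card_mult: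
  fixes T :: real
  assumes x: "x \<in> {0..vec T}"
  shows "0 \<le> L x \<and> L x \<le> CARD('n) * T"
proof -
  from x have "L x \<le> (\<Sum>i\<in>UNIV. x $ i)" by (intro le_sum) auto
  also have "\<dots> \<le> (\<Sum>i\<in>(UNIV :: 'n set). T)" using x by (intro sum_mono) (simp add: less_eq_vec_def)
  finally show ?thesis using nonneg[of x] x by simp
qed

lemma component_le: "0 \<le> x \<Longrightarrow> x $ i \<le> L x"
proof -
  assume x: "0 \<le> x"
  show ?thesis
  proof (cases "x $ i = 0")
    case False
    then have "0 < x $ i" using x by (simp add: less_eq_vec_def order_le_less) metis
    then have "L (x $ i *\<^sub>R axis i 1) = x $ i"
      using scale[of "axis i 1" "x $ i"] axis by (simp add: less_eq_vec_def axis_def)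
    moreover have "L (x $ i *\<^sub>R axis i 1) \<le> L x"
      using x by (intro mono) (auto simp: less_eq_vec_def axis_def)
    ultimately show ?thesis by simp
  qed (simp add: nonneg x)
qed

text \<open>
  Monotonicity and subadditivity give \<open>L x \<le> L (y + \<bar>x - y\<bar>) \<le> L y + L \<bar>x - y\<bar>\<close>.
\<close>

lemma le_plus_l1:
  assumes "0 \<le> x" "0 \<le> y"
  shows "L x \<le> L y + (\<Sum>i\<in>UNIV. \<bar>x $ i - y $ i\<bar>)"
proof -
  let ?d = "\<chi> i. \<bar>x $ i - y $ i\<bar>"
  have d: "0 \<le> ?d" by (simp add: less_eq_vec_def)
  have "L x \<le> L (y + ?d)"
    using assms(1) by (rule mono) (simp add: less_eq_vec_def abs_if)
  also have "\<dots> \<le> L y + L ?d" by (intro subadd assms d)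
  also have "L ?d \<le> (\<Sum>i\<in>UNIV. \<bar>x $ i - y $ i\<bar>)" using le_sum[OF d] by simp
  finally show ?thesis by simp
qed

lemma lipschitz_l1: "\<lbrakk>0 \<le> x; 0 \<le> y\<rbrakk> \<Longrightarrow> \<bar>L x - L y\<bar> \<le> (\<Sum>i\<in>UNIV. \<bar>x $ i - y $ i\<bar>)"
  using le_plus_l1[of x y] le_plus_l1[of y x] by (simp add: abs_minus_commute)

lemma continuous: "continuous_on {0..} L"
  by (rule continuous_on_l1) (auto intro: le_plus_l1)

text \<open>
  By homogeneity \<open>L\<close> equals \<open>m\<close> at the vector with all components \<open>m\<close>, and for \<open>m = L_max x\<close> this
  vector dominates \<open>x\<close>.
\<close>

lemma eq_L_max_of_one:
  assumes "L 1 = 1" "0 \<le> x"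
  shows "L x = L_max x"
proof (rule antisym)
  have max_ge: "x $ i \<le> L_max x" for i
    unfolding L_max_def by (intro Max_ge) auto
  show "L_max x \<le> L x"
    unfolding L_max_def using component_le[OF assms(2)] by (intro Max.boundedI) auto
  show "L x \<le> L_max x"
  proof (cases "x = 0")
    case False
    then obtain i where "x $ i \<noteq> 0" by (auto simp: vec_eq_iff)
    then have "0 < x $ i" using assms(2) by (simp add: less_eq_vec_def order_le_less) metis
    then have "0 < L_max x" using max_ge[of i] by simp
    then have "L (L_max x *\<^sub>R 1) = L_max x"
      using scale[of 1 "L_max x"] assms(1) by (simp add: less_eq_vec_def)
    moreover have "L x \<le> L (L_max x *\<^sub>R 1)"
      using max_ge by (intro mono assms(2)) (simp add: less_eq_vec_def)
    ultimately show ?thesis by simp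
  qed (use max_ge[of undefined] in \<open>simp add: zero\<close>)
qed

text \<open>
  The slopes of a convex function along a ray increase with the step length, here \<open>1/r\<close>: the shorter
  step ends on the segment between \<open>x\<close> and the end \<open>?w\<close> of the longer one.
\<close>

lemma square_slope_decreasing:
  assumes x: "x \<in> {0..vec T}" and \<sigma>: "\<bar>\<sigma>\<bar> \<le> 1" and r: "T \<le> r" "0 < r" "r \<le> s"
  shows "square_slope L \<sigma> s x \<le> square_slope L \<sigma> r x"
proof -
  have s: "0 < s" "T \<le> s" using r by auto
  have x0: "0 \<le> x" using x by simp
  let ?a = "r / s"
  let ?w = "x + (\<sigma> / r) *\<^sub>R x\<^sup>2"
  have w: "0 \<le> ?w" by (rule square_shift_nonneg[OF x \<sigma> r(1,2)])
  have a: "0 < ?a" "?a \<le> 1" using r s by auto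
  have convex: "L ((1 - ?a) *\<^sub>R x + ?a *\<^sub>R ?w) \<le> (1 - ?a) * L x + ?a * L ?w"
  proof (cases "?a = 1")
    case False
    then have a': "0 < 1 - ?a" using a by linarith
    have "L ((1 - ?a) *\<^sub>R x + ?a *\<^sub>R ?w) \<le> L ((1 - ?a) *\<^sub>R x) + L (?a *\<^sub>R ?w)"
      using a(1) a' by (intro subadd scaleR_vec_nonneg x0 w) auto
    then show ?thesis using scale[OF x0 a'] scale[OF w a(1)] by simp
  qed simp
  have "x + (\<sigma> / s) *\<^sub>R x\<^sup>2 = (1 - ?a) *\<^sub>R x + ?a *\<^sub>R ?w"
    using r s by (simp add: algebra_simps)
  then have "L (x + (\<sigma> / s) *\<^sub>R x\<^sup>2) - L x \<le> ?a * (L ?w - L x)"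
    using convex r by (simp add: algebra_simps)
  then have "s * (L (x + (\<sigma> / s) *\<^sub>R x\<^sup>2) - L x) \<le> s * (?a * (L ?w - L x))"
    using s by (intro mult_left_mono) auto
  then show ?thesis using s by (simp add: square_slope_def)
qed

lemma abs_square_slope_le:
  fixes T :: real
  assumes x: "x \<in> {0..vec T}" and \<sigma>: "\<bar>\<sigma>\<bar> \<le> 1" and r: "T \<le> r" "0 < r"
  shows "\<bar>square_slope L \<sigma> r x\<bar> \<le> CARD('n) * T\<^sup>2"
proof -
  have "\<bar>L (x + (\<sigma> / r) *\<^sub>R x\<^sup>2) - L x\<bar> \<le> (\<Sum>i\<in>UNIV. \<bar>(x + (\<sigma> / r) *\<^sub>R x\<^sup>2) $ i - x $ i\<bar>)"
    using x by (intro lipschitz_l1 square_shift_nonneg[OF x \<sigma> r]) auto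
  also have "\<dots> \<le> (\<Sum>i\<in>(UNIV :: 'n set). T\<^sup>2 / r)"
  proof (intro sum_mono)
    fix i
    have "\<bar>\<sigma>\<bar> * (x $ i)\<^sup>2 \<le> 1 * T\<^sup>2"
      using x \<sigma> by (intro mult_mono power_mono) (auto simp: less_eq_vec_def)
    then show "\<bar>(x + (\<sigma> / r) *\<^sub>R x\<^sup>2) $ i - x $ i\<bar> \<le> T\<^sup>2 / r"
      using r by (simp add: power2_vec_component abs_mult divide_right_mono)
  qed
  finally have "r * \<bar>L (x + (\<sigma> / r) *\<^sub>R x\<^sup>2) - L x\<bar> \<le> r * (CARD('n) * (T\<^sup>2 / r))"
    using r by (intro mult_left_mono) auto
  then show ?thesis using r by (simp add: square_slope_def abs_mult)
qed

lemma square_slope_convergent: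
  assumes x: "0 \<le> x" and \<sigma>: "\<bar>\<sigma>\<bar> \<le> 1"
  shows "\<exists>l. ((\<lambda>r. square_slope L \<sigma> r x) \<longlongrightarrow> l) at_top"
proof -
  define T where "T = norm x + 1"
  have T: "0 < T" by (simp add: T_def add_nonneg_pos)
  have xT: "x \<in> {0..vec T}" unfolding T_def
    using x by (rule in_Icc_norm)
  define f where "f r = - square_slope L \<sigma> (max T r) x" for r
  have mono_f: "mono f"
    using T by (intro monoI) (auto simp: f_def intro!: square_slope_decreasing[OF xT \<sigma>])
  have bdd: "f r \<le> CARD('n) * T\<^sup>2" for r
  proof -
    have "0 < max T r" using T by simp
    from abs_square_slope_le[OF xT \<sigma> _ this] show ?thesis by (simp add: f_def)
  qed
  have "incseq (\<lambda>n. f (real n))" using mono_f by (auto simp: mono_def)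
  then obtain l where "(\<lambda>n. f (real n)) \<longlonglongrightarrow> l"
    using bdd by (elim incseq_convergent) auto
  then have "(f \<longlongrightarrow> l) at_top"
    by (rule tendsto_at_topI_sequentially_real[OF mono_f])
  then have "((\<lambda>r. - f r) \<longlongrightarrow> - l) at_top" by (rule tendsto_minus)
  moreover have "\<forall>\<^sub>F r in at_top. - f r = square_slope L \<sigma> r x"
    by (rule eventually_at_top_linorderI[of T]) (simp add: f_def max_def)
  ultimately have "((\<lambda>r. square_slope L \<sigma> r x) \<longlongrightarrow> - l) at_top"
    by (rule Lim_transform_eventually)
  then show ?thesis ..
qed

lemma Gamma1_tendsto:
  assumes "0 \<le> x"
  shows "((\<lambda>r. square_slope L 1 r x) \<longlongrightarrow> Gamma1 L x) at_top"
proof -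
  obtain l where l: "((\<lambda>r. square_slope L 1 r x) \<longlongrightarrow> l) at_top"
    using square_slope_convergent[OF assms, of 1] by auto
  then have "Gamma1 L x = l"
    unfolding Gamma1_def by (intro tendsto_Lim) (simp_all add: square_slope_def divide_inverse)
  then show ?thesis using l by simp
qed

lemma Gamma2_tendsto:
  assumes "0 \<le> x"
  shows "((\<lambda>r. square_slope L (- 1) r x) \<longlongrightarrow> - Gamma2 L x) at_top"
proof -
  obtain l where l: "((\<lambda>r. square_slope L (- 1) r x) \<longlongrightarrow> l) at_top"
    using square_slope_convergent[OF assms, of "- 1"] by auto
  have "((\<lambda>r. r * (L x - L (x - x\<^sup>2 /\<^sub>R r))) \<longlongrightarrow> - l) at_top"
    using tendsto_minus[OF l] by (simp add: square_slope_def divide_inverse algebra_simps)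
  then have "Gamma2 L x = - l"
    unfolding Gamma2_def by (intro tendsto_Lim) simp_all
  then show ?thesis using l by simp
qed

text \<open>
  At the vector 1 the shift is radial, so homogeneity evaluates the slope exactly.
\<close>

lemma square_slope_one: "r > 1 \<Longrightarrow> \<bar>\<sigma>\<bar> \<le> 1 \<Longrightarrow> square_slope L \<sigma> r 1 = \<sigma> * L 1"
proof -
  assume r: "r > 1" and \<sigma>: "\<bar>\<sigma>\<bar> \<le> 1"
  have "\<bar>\<sigma>\<bar> < r" using r \<sigma> by simp
  then have "0 < 1 + \<sigma> / r" using r by (simp add: field_simps abs_less_iff)
  moreover have "1 + (\<sigma> / r) *\<^sub>R 1\<^sup>2 = (1 + \<sigma> / r) *\<^sub>R (1 :: real ^ 'n)"
    by (simp add: vec_eq_iff)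
  ultimately show ?thesis using scale[of 1 "1 + \<sigma> / r"] r
    by (simp add: square_slope_def less_eq_vec_def field_simps)
qed

lemma Gamma1_one: "Gamma1 L 1 = L 1"
proof -
  have "\<forall>\<^sub>F r in at_top. square_slope L 1 r 1 = L 1"
    using eventually_gt_at_top[of 1] by eventually_elim (simp add: square_slope_one)
  then have "((\<lambda>r. square_slope L 1 r 1) \<longlongrightarrow> L 1) at_top" by (rule tendsto_eventually)
  from tendsto_unique[OF _ this Gamma1_tendsto] show ?thesis by (simp add: less_eq_vec_def)
qed

lemma Gamma2_one: "Gamma2 L 1 = L 1"
proof -
  have "\<forall>\<^sub>F r in at_top. square_slope L (- 1) r 1 = - L 1"
    using eventually_gt_at_top[of 1] by eventually_elim (simp add: square_slope_one)
  then have "((\<lambda>r. square_slope L (- 1) r 1) \<longlongrightarrow> - L 1) at_top" by (rule tendsto_eventually)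
  from tendsto_unique[OF _ this Gamma2_tendsto] show ?thesis by (simp add: less_eq_vec_def)
qed

lemma square_slope_uniform:
  assumes lim: "\<And>x. 0 \<le> x \<Longrightarrow> ((\<lambda>r. square_slope L \<sigma> r x) \<longlongrightarrow> D x) at_top"
    and D: "continuous_on {0..} D" and \<sigma>: "\<bar>\<sigma>\<bar> \<le> 1" and T: "0 < T"
  shows "uniform_limit {0..vec T} (square_slope L \<sigma>) D at_top"
proof (rule uniform_limit_decreasing[where c = T])
  show "continuous_on {0..vec T} (square_slope L \<sigma> r)" if "T \<le> r" for r
  proof -
    have shift: "continuous_on {0..vec T} (\<lambda>x :: real ^ 'n. x + (\<sigma> / r) *\<^sub>R x\<^sup>2)"
    proof -
      have eq: "(\<lambda>x :: real ^ 'n. x\<^sup>2) = (\<lambda>x. \<chi> i. (x $ i)\<^sup>2)"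
        by (simp add: fun_eq_iff vec_eq_iff power2_vec_component)
      have "continuous_on {0..vec T} (\<lambda>x :: real ^ 'n. x\<^sup>2)"
        unfolding eq by (intro continuous_intros)
      then show ?thesis by (intro continuous_intros)
    qed
    have "continuous_on {0..vec T} (\<lambda>x. L (x + (\<sigma> / r) *\<^sub>R x\<^sup>2))"
      by (rule continuous_on_compose2[OF continuous shift])
        (use square_shift_nonneg \<sigma> T that in fastforce)
    moreover have "continuous_on {0..vec T} L"
      by (rule continuous_on_subset[OF continuous]) auto
    ultimately show ?thesis
      unfolding square_slope_def by (intro continuous_intros) auto
  qed
  show "continuous_on {0..vec T} D" by (rule continuous_on_subset[OF D]) auto
qed (use T \<sigma> lim in \<open>auto intro: square_slope_decreasing\<close>)

end

section \<open>Second order effect of a change of scale\<close>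

text \<open>
  A Taylor expansion with second derivative \<open>\<sigma>\<close> at 0. Nonnegativity keeps rescaled points in the
  nonnegative orthant.
\<close>

definition tangent_to_identity :: "real \<Rightarrow> (real \<Rightarrow> real) \<Rightarrow> bool" where
  "tangent_to_identity \<sigma> k \<longleftrightarrow> k 0 = 0 \<and> (\<forall>s\<in>{0..<1}. 0 \<le> k s) \<and>
     ((\<lambda>s. (k s - s) / s\<^sup>2) \<longlongrightarrow> \<sigma> / 2) (at_right 0)"

lemma tangent_to_identity_ln: "tangent_to_identity 1 (\<lambda>s. - ln (1 - s))"
  unfolding tangent_to_identity_def by (auto simp: ln_le_zero_iff) real_asymp

lemma tangent_to_identity_exp: "tangent_to_identity (- 1) (\<lambda>s. 1 - exp (- s))"
  unfolding tangent_to_identity_def by auto real_asymp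

text \<open>
  With \<open>s = v/r\<close> the expression is \<open>2 v\<^sup>2 (k s - s)/s\<^sup>2\<close>, and \<open>s\<close> tends to 0 uniformly for \<open>v \<le> T\<close>.
\<close>

lemma tangent_to_identity_uniform:
  assumes k: "tangent_to_identity \<sigma> k" and T: "0 < T"
  shows "uniform_limit {0..T} (\<lambda>r v. 2 * r * (r * k (v / r) - v)) (\<lambda>v. \<sigma> * v\<^sup>2) at_top"
proof (rule uniform_limitI)
  fix e :: real assume "0 < e"
  \<comment> \<open>the error \<open>d\<close> is multiplied by \<open>2 v\<^sup>2 \<le> 2 T\<^sup>2\<close> below\<close>
  define d where "d = e / (2 * T\<^sup>2)"
  have d: "0 < d" using \<open>0 < e\<close> T by (simp add: d_def)
  have "\<forall>\<^sub>F s in at_right 0. dist ((k s - s) / s\<^sup>2) (\<sigma> / 2) < d"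
    using k d unfolding tangent_to_identity_def tendsto_iff by auto
  then obtain b where b: "0 < b" "\<And>s. \<lbrakk>0 < s; s < b\<rbrakk> \<Longrightarrow> dist ((k s - s) / s\<^sup>2) (\<sigma> / 2) < d"
    unfolding eventually_at_right_field by auto
  show "\<forall>\<^sub>F r in at_top. \<forall>v\<in>{0..T}. dist (2 * r * (r * k (v / r) - v)) (\<sigma> * v\<^sup>2) < e"
    using eventually_gt_at_top[of "T / b"] eventually_gt_at_top[of 0]
  proof eventually_elim
    case (elim r)
    show ?case
    proof
      fix v assume v: "v \<in> {0..T}"
      show "dist (2 * r * (r * k (v / r) - v)) (\<sigma> * v\<^sup>2) < e"
      proof (cases "v = 0")
        case True
        then show ?thesis using k \<open>0 < e\<close> by (simp add: tangent_to_identity_def)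
      next
        case False
        define s where "s = v / r"
        have "v < b * r" using v elim b(1) by (auto simp: field_simps)
        then have s: "0 < s" "s < b" and v_eq: "v = r * s" using v False elim by (auto simp: s_def field_simps)
        have v2: "0 < v\<^sup>2" "v\<^sup>2 \<le> T\<^sup>2" using v False by (auto intro: power_mono)
        have "2 * r * (r * k (v / r) - v) - \<sigma> * v\<^sup>2 = 2 * v\<^sup>2 * ((k s - s) / s\<^sup>2 - \<sigma> / 2)"
          using s elim by (simp add: v_eq field_simps power2_eq_square)
        then have "dist (2 * r * (r * k (v / r) - v)) (\<sigma> * v\<^sup>2)
            = 2 * v\<^sup>2 * dist ((k s - s) / s\<^sup>2) (\<sigma> / 2)"
          by (simp add: dist_real_def abs_mult)
        also have "\<dots> < 2 * v\<^sup>2 * d" using b(2)[OF s] v2 by (intro mult_strict_left_mono) auto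
        also have "\<dots> \<le> 2 * T\<^sup>2 * d" using v2 d by (intro mult_right_mono) auto
        also have "\<dots> = e" using T by (simp add: d_def)
        finally show ?thesis .
      qed
    qed
  qed
qed

definition rescaled :: "(real \<Rightarrow> real) \<Rightarrow> real \<Rightarrow> real ^ 'n \<Rightarrow> real ^ 'n" where
  "rescaled k r x = (\<chi> i. r * k (x $ i / r))"

lemma rescaled_expansion:
  assumes k: "tangent_to_identity \<sigma> k" and T: "0 < T"
  shows "uniform_limit {0..vec T :: real ^ 'n}
     (\<lambda>r x. 2 * r * (\<Sum>i\<in>UNIV. \<bar>rescaled k r x $ i - (x + (\<sigma> / (2 * r)) *\<^sub>R x\<^sup>2) $ i\<bar>)) (\<lambda>x. 0) at_top"
proof (rule uniform_limitI)
  fix e :: real assume "0 < e"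
  define d where "d = e / (2 * CARD('n))"
  have d: "0 < d" using \<open>0 < e\<close> by (simp add: d_def)
  from uniform_limitD[OF tangent_to_identity_uniform[OF k T] d] eventually_gt_at_top[of 0]
  show "\<forall>\<^sub>F r in at_top. \<forall>x\<in>{0..vec T :: real ^ 'n}.
     dist (2 * r * (\<Sum>i\<in>UNIV. \<bar>rescaled k r x $ i - (x + (\<sigma> / (2 * r)) *\<^sub>R x\<^sup>2) $ i\<bar>)) 0 < e"
  proof eventually_elim
    case (elim r)
    show ?case
    proof
      fix x :: "real ^ 'n" assume x: "x \<in> {0..vec T}"
      have "2 * r * \<bar>rescaled k r x $ i - (x + (\<sigma> / (2 * r)) *\<^sub>R x\<^sup>2) $ i\<bar> \<le> d" for i
      proof -
        have "2 * r * \<bar>rescaled k r x $ i - (x + (\<sigma> / (2 * r)) *\<^sub>R x\<^sup>2) $ i\<bar>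
            = \<bar>2 * r * (rescaled k r x $ i - (x + (\<sigma> / (2 * r)) *\<^sub>R x\<^sup>2) $ i)\<bar>"
          using elim by (simp add: abs_mult)
        also have "2 * r * (rescaled k r x $ i - (x + (\<sigma> / (2 * r)) *\<^sub>R x\<^sup>2) $ i)
            = 2 * r * (r * k (x $ i / r) - x $ i) - \<sigma> * (x $ i)\<^sup>2"
          using elim by (simp add: rescaled_def power2_vec_component algebra_simps)
        also have "\<bar>\<dots>\<bar> \<le> d"
          using elim(1)[rule_format, of "x $ i"] x by (simp add: less_eq_vec_def dist_real_def)
        finally show ?thesis .
      qed
      then have "(\<Sum>i\<in>(UNIV :: 'n set). 2 * r * \<bar>rescaled k r x $ i - (x + (\<sigma> / (2 * r)) *\<^sub>R x\<^sup>2) $ i\<bar>)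
          \<le> (\<Sum>i\<in>(UNIV :: 'n set). d)"
        by (intro sum_mono)
      then have "2 * r * (\<Sum>i\<in>UNIV. \<bar>rescaled k r x $ i - (x + (\<sigma> / (2 * r)) *\<^sub>R x\<^sup>2) $ i\<bar>) \<le> e / 2"
        by (simp add: sum_distrib_left d_def)
      moreover have "0 \<le> 2 * r * (\<Sum>i\<in>UNIV. \<bar>rescaled k r x $ i - (x + (\<sigma> / (2 * r)) *\<^sub>R x\<^sup>2) $ i\<bar>)"
        using elim by (intro mult_nonneg_nonneg sum_nonneg) auto
      ultimately show "dist (2 * r * (\<Sum>i\<in>UNIV. \<bar>rescaled k r x $ i - (x + (\<sigma> / (2 * r)) *\<^sub>R x\<^sup>2) $ i\<bar>)) 0 < e"
        using \<open>0 < e\<close> by (simp add: dist_real_def)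
    qed
  qed
qed

lemma rescaled_nonneg:
  assumes "tangent_to_identity \<sigma> k" "x \<in> {0..vec T}" "T < r" "0 < r"
  shows "0 \<le> rescaled k r x"
proof -
  have "x $ i / r \<in> {0..<1}" for i
    using assms by (auto simp: less_eq_vec_def intro: le_less_trans)
  then show ?thesis
    using assms by (simp add: tangent_to_identity_def less_eq_vec_def rescaled_def)
qed

lemma rescaled_uniform_l1:
  assumes k: "tangent_to_identity \<sigma> k" and T: "0 < T"
  shows "uniform_limit {0..vec T :: real ^ 'n} (\<lambda>r x. \<Sum>i\<in>UNIV. \<bar>rescaled k r x $ i - x $ i\<bar>) (\<lambda>x. 0) at_top"
proof (rule uniform_limit_null_comparison)
  let ?E = "\<lambda>r x. 2 * r * (\<Sum>i\<in>(UNIV :: 'n set). \<bar>rescaled k r x $ i - (x + (\<sigma> / (2 * r)) *\<^sub>R x\<^sup>2) $ i\<bar>)"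
  let ?b = "\<lambda>r x. 1 / (2 * r) * ?E r x + CARD('n) * \<bar>\<sigma>\<bar> * T\<^sup>2 / (2 * r)"
  show "\<forall>\<^sub>F r in at_top. \<forall>x\<in>{0..vec T}. norm (\<Sum>i\<in>(UNIV :: 'n set). \<bar>rescaled k r x $ i - x $ i\<bar>) \<le> ?b r x"
    using eventually_gt_at_top[of 0]
  proof (eventually_elim, intro ballI)
    fix r :: real and x :: "real ^ 'n" assume r: "0 < r" and x: "x \<in> {0..vec T}"
    have "\<bar>rescaled k r x $ i - x $ i\<bar>
        \<le> \<bar>rescaled k r x $ i - (x + (\<sigma> / (2 * r)) *\<^sub>R x\<^sup>2) $ i\<bar> + \<bar>\<sigma>\<bar> * T\<^sup>2 / (2 * r)" for i
    proof -
      have "(x $ i)\<^sup>2 \<le> T\<^sup>2" using x by (intro power_mono) (auto simp: less_eq_vec_def)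
      then have "\<bar>(\<sigma> / (2 * r)) * (x $ i)\<^sup>2\<bar> \<le> \<bar>\<sigma>\<bar> * T\<^sup>2 / (2 * r)"
        using r by (simp add: abs_mult divide_right_mono mult_left_mono)
      moreover have "\<bar>p - q\<bar> \<le> \<bar>p - (q + z)\<bar> + \<bar>z\<bar>" for p q z :: real by linarith
      ultimately show ?thesis
        by (simp only: vector_add_component vector_scaleR_component power2_vec_component real_scaleR_def)
    qed
    then have "(\<Sum>i\<in>(UNIV :: 'n set). \<bar>rescaled k r x $ i - x $ i\<bar>) \<le>
       (\<Sum>i\<in>(UNIV :: 'n set). \<bar>rescaled k r x $ i - (x + (\<sigma> / (2 * r)) *\<^sub>R x\<^sup>2) $ i\<bar> + \<bar>\<sigma>\<bar> * T\<^sup>2 / (2 * r))"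
      by (intro sum_mono)
    then show "norm (\<Sum>i\<in>(UNIV :: 'n set). \<bar>rescaled k r x $ i - x $ i\<bar>) \<le> ?b r x"
      using r by (simp add: sum.distrib sum_nonneg)
  qed
  have "((\<lambda>r::real. 1 / (2 * r)) \<longlongrightarrow> 0) at_top" by real_asymp
  moreover have "bounded ((\<lambda>_. 0 :: real) ` {0..vec T :: real ^ 'n})"
    by (auto simp: image_constant_conv)
  ultimately have "uniform_limit {0..vec T} (\<lambda>r x. 1 / (2 * r) * ?E r x) (\<lambda>x. 0 * 0) at_top"
    using rescaled_expansion[OF k T] by (intro uniform_limit_cmult)
  then have 1: "uniform_limit {0..vec T} (\<lambda>r x. 1 / (2 * r) * ?E r x) (\<lambda>x. 0) at_top"
    by (simp only: mult_zero_left)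
  have "((\<lambda>r::real. CARD('n) * \<bar>\<sigma>\<bar> * T\<^sup>2 / (2 * r)) \<longlongrightarrow> 0) at_top" by real_asymp
  from uniform_limit_add[OF 1 uniform_limit_of_tendsto[OF this]]
  show "uniform_limit {0..vec T} ?b (\<lambda>x. 0) at_top" by simp
qed

lemma rescaled_uniform:
  assumes k: "tangent_to_identity \<sigma> k" and T: "0 < T"
  shows "uniform_limit {0..vec T :: real ^ 'n} (rescaled k) (\<lambda>x. x) at_top"
proof (rule uniform_limitI)
  fix e :: real assume "0 < e"
  from uniform_limitD[OF rescaled_uniform_l1[OF k T, where 'n = 'n] this]
  show "\<forall>\<^sub>F r in at_top. \<forall>x\<in>{0..vec T :: real ^ 'n}. dist (rescaled k r x) x < e"
  proof eventually_elim
    case (elim r)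
    then show ?case
      by (auto simp: dist_norm intro!: le_less_trans[OF norm_le_l1_cart] dest!: bspec)
  qed
qed

lemma rescaled_eventually_in:
  assumes k: "tangent_to_identity \<sigma> k" and T: "0 < T"
  shows "\<forall>\<^sub>F r in at_top. rescaled k r ` {0..vec T :: real ^ 'n} \<subseteq> {0..vec (T + 1)}"
  using uniform_limitD[OF rescaled_uniform[OF k T, where 'n = 'n] zero_less_one] eventually_gt_at_top[of T]
proof eventually_elim
  case (elim r)
  show ?case
  proof
    fix y assume "y \<in> rescaled k r ` {0..vec T :: real ^ 'n}"
    then obtain x where y: "y = rescaled k r x" and x: "x \<in> {0..vec T :: real ^ 'n}" by auto
    have "y $ i \<le> T + 1" for i
    proof -
      have "\<bar>(y - x) $ i\<bar> \<le> 1"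
        using elim(1) x y component_le_norm_cart[of "y - x" i] by (fastforce simp: dist_norm)
      moreover have "x $ i \<le> T" using x by (simp add: less_eq_vec_def)
      ultimately show ?thesis by simp
    qed
    moreover have "0 \<le> y" unfolding y using elim T by (intro rescaled_nonneg[OF k x]) auto
    ultimately show "y \<in> {0..vec (T + 1)}" by (simp add: less_eq_vec_def)
  qed
qed

context stable_tail
begin

text \<open>
  Replacing \<open>rescaled k r x\<close> by its second order expansion changes \<open>L\<close> by \<open>o(1/r)\<close>, by the Lipschitz
  bound.
\<close>

lemma increment_uniform:
  fixes K :: "(real ^ 'n) set"
  assumes k: "tangent_to_identity \<sigma> k" and T: "0 < T" and K: "K \<subseteq> {0..vec T}"
    and \<sigma>: "\<bar>\<sigma>\<bar> \<le> 1"
  shows "uniform_limit K (\<lambda>r x. 2 * r * (L (rescaled k r x) - L x) - square_slope L \<sigma> (2 * r) x) (\<lambda>x. 0) at_top"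
proof (rule uniform_limit_null_comparison)
  show "uniform_limit K (\<lambda>r x. 2 * r * (\<Sum>i\<in>(UNIV :: 'n set).
      \<bar>rescaled k r x $ i - (x + (\<sigma> / (2 * r)) *\<^sub>R x\<^sup>2) $ i\<bar>)) (\<lambda>x. 0) at_top"
    by (rule uniform_limit_on_subset[OF rescaled_expansion[OF k T] K])
  show "\<forall>\<^sub>F r in at_top. \<forall>x\<in>K. norm (2 * r * (L (rescaled k r x) - L x) - square_slope L \<sigma> (2 * r) x)
      \<le> 2 * r * (\<Sum>i\<in>(UNIV :: 'n set). \<bar>rescaled k r x $ i - (x + (\<sigma> / (2 * r)) *\<^sub>R x\<^sup>2) $ i\<bar>)"
    using eventually_gt_at_top[of T]
  proof (eventually_elim, intro ballI)
    fix r x assume r: "T < r" and "x \<in> K"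
    then have x: "x \<in> {0..vec T}" using K by auto
    have "2 * r * (L (rescaled k r x) - L x) - square_slope L \<sigma> (2 * r) x
        = 2 * r * (L (rescaled k r x) - L (x + (\<sigma> / (2 * r)) *\<^sub>R x\<^sup>2))"
      by (simp add: square_slope_def algebra_simps)
    then have "norm (2 * r * (L (rescaled k r x) - L x) - square_slope L \<sigma> (2 * r) x)
        = 2 * r * \<bar>L (rescaled k r x) - L (x + (\<sigma> / (2 * r)) *\<^sub>R x\<^sup>2)\<bar>"
      using r T by (simp add: abs_mult)
    also have "\<dots> \<le> 2 * r * (\<Sum>i\<in>UNIV. \<bar>rescaled k r x $ i - (x + (\<sigma> / (2 * r)) *\<^sub>R x\<^sup>2) $ i\<bar>)"
      using r T
      by (intro mult_left_mono lipschitz_l1 rescaled_nonneg[OF k x] square_shift_nonneg[OF x \<sigma>]) auto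
    finally show "norm (2 * r * (L (rescaled k r x) - L x) - square_slope L \<sigma> (2 * r) x)
      \<le> 2 * r * (\<Sum>i\<in>UNIV. \<bar>rescaled k r x $ i - (x + (\<sigma> / (2 * r)) *\<^sub>R x\<^sup>2) $ i\<bar>)" .
  qed
qed

lemma slope_limit_bounded:
  assumes "uniform_limit K (square_slope L \<sigma>) D at_top" "\<bar>\<sigma>\<bar> \<le> 1" "K \<subseteq> {0..vec T}"
  shows "bounded (D ` K)"
proof (rule boundedI)
  fix v assume "v \<in> D ` K"
  then obtain x where x: "x \<in> K" "v = D x" by auto
  have "((\<lambda>r. norm (square_slope L \<sigma> r x)) \<longlongrightarrow> norm v) at_top"
    using tendsto_uniform_limitI[OF assms(1) x(1)] x(2) by (intro tendsto_norm) simp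
  moreover have "\<forall>\<^sub>F r in at_top. norm (square_slope L \<sigma> r x) \<le> CARD('n) * T\<^sup>2"
    using eventually_ge_at_top[of T] eventually_gt_at_top[of 0]
    by eventually_elim (use abs_square_slope_le assms x in auto)
  ultimately show "norm v \<le> CARD('n) * T\<^sup>2" by (rule tendsto_upperbound) simp
qed

lemma bounded_second_order_limit:
  assumes S: "bounded (S ` K)" and K: "K \<subseteq> {0..vec T}" and \<sigma>: "\<bar>\<sigma>\<bar> \<le> 1"
    and D: "b = 0 \<or> uniform_limit K (square_slope L (- \<sigma>)) D at_top"
  shows "bounded ((\<lambda>x. a * S x + b * (\<sigma> * (L x)\<^sup>2 + D x)) ` K)"
proof -
  have scaled: "bounded ((\<lambda>x. c * f x) ` K)" if "bounded (f ` K)" for f :: "real ^ 'n \<Rightarrow> real" and c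
    using bounded_scaling[OF that, where c = c] by (simp add: image_image)
  have "continuous_on {0..vec T} L" by (rule continuous_on_subset[OF continuous]) simp
  then have "bounded ((\<lambda>x. (L x)\<^sup>2) ` {0..vec T})"
    by (intro compact_imp_bounded compact_continuous_image continuous_intros compact_Icc_vec)
  then have "bounded ((\<lambda>x. (L x)\<^sup>2) ` K)" by (rule bounded_subset) (use K in auto)
  then have 1: "bounded ((\<lambda>x. b * (\<sigma> * (L x)\<^sup>2)) ` K)" by (intro scaled)
  have 2: "bounded ((\<lambda>x. b * D x) ` K)"
  proof (cases "b = 0")
    case True
    then show ?thesis by (simp add: image_constant_conv)
  next
    case False
    then show ?thesis using D slope_limit_bounded[where \<sigma> = "- \<sigma>" and T = T] \<sigma> K by (intro scaled) auto
  qed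
  show ?thesis
    using bounded_plus_comp[OF scaled[OF S, where c = a] bounded_plus_comp[OF 1 2]]
    by (simp add: algebra_simps)
qed

text \<open>
  Write \<open>y = rescaled k' r x\<close> and \<open>w = A r y\<close>. Then \<open>B r x - L x\<close> is the sum of
  \<open>r k(w/r) - w \<approx> \<sigma> (L x)\<^sup>2/(2r)\<close>, of \<open>A r y - L y \<approx> \<alpha> r S x\<close>, and of
  \<open>L y - L x\<close>, which is a slope of \<open>L\<close> in the direction \<open>- \<sigma> x\<^sup>2\<close> up to the factor \<open>1/(2r)\<close>.
  The numbers \<open>a\<close> and \<open>b\<close> are the limiting weights of \<open>\<alpha> r\<close> and \<open>1/(2r)\<close> relative to the new rate.
  If \<open>b = 0\<close>, boundedness of the slopes suffices. The set \<open>K\<close> is a box when uniform convergence is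
  wanted and a single point when the slopes are only known to converge pointwise.
\<close>

lemma second_order_change_of_scale:
  fixes A B :: "real \<Rightarrow> real ^ 'n \<Rightarrow> real"
  assumes k: "tangent_to_identity \<sigma> k" and k': "tangent_to_identity (- \<sigma>) k'" and \<sigma>: "\<bar>\<sigma>\<bar> \<le> 1"
    and A: "\<And>T. 0 < T \<Longrightarrow> uniform_limit {0..vec T} (\<lambda>r x. (A r x - L x) / \<alpha> r) S at_top"
    and A_nonneg: "\<And>T. 0 < T \<Longrightarrow> \<forall>\<^sub>F r in at_top. \<forall>x\<in>{0..vec T}. 0 \<le> A r x"
    and S: "\<And>T. 0 < T \<Longrightarrow> continuous_on {0..vec T} S"
    and \<alpha>: "(\<alpha> \<longlongrightarrow> 0) at_top" "\<And>r. 0 < r \<Longrightarrow> 0 < \<alpha> r" and \<beta>: "\<And>r. 0 < r \<Longrightarrow> 0 < \<beta> r"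
    and T: "0 < T" and K: "K \<subseteq> {0..vec T}"
    and B: "\<forall>\<^sub>F r in at_top. \<forall>x\<in>K. B r x = r * k (A r (rescaled k' r x) / r)"
    and a: "((\<lambda>r. \<alpha> r / \<beta> r) \<longlongrightarrow> a) at_top" and b: "((\<lambda>r. 1 / (2 * r * \<beta> r)) \<longlongrightarrow> b) at_top"
    and D: "b = 0 \<or> uniform_limit K (square_slope L (- \<sigma>)) D at_top"
  shows "uniform_limit K (\<lambda>r x. (B r x - L x) / \<beta> r) (\<lambda>x. a * S x + b * (\<sigma> * (L x)\<^sup>2 + D x)) at_top"
proof -
  define y where "y = (rescaled k' :: real \<Rightarrow> real ^ 'n \<Rightarrow> _)"
  define Q where "Q r x = (A r x - L x) / \<alpha> r" for r x
  define w where "w r x = A r (y r x)" for r x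
  have T1: "0 < T + 1" using T by simp
  have y_lim: "uniform_limit K y (\<lambda>x. x) at_top"
    unfolding y_def by (rule uniform_limit_on_subset[OF rescaled_uniform[OF k' T] K])
  have y_in: "\<forall>\<^sub>F r in at_top. y r ` K \<subseteq> {0..vec (T + 1)}"
    unfolding y_def using rescaled_eventually_in[OF k' T] by eventually_elim (use K in auto)
  have K1: "(\<lambda>x. x) ` K \<subseteq> {0..vec (T + 1)}"
    using K by (auto simp: less_eq_vec_def subset_iff) (smt (verit))
  have A_lim: "uniform_limit {0..vec (T + 1)} A L at_top"
  proof -
    have "bounded (S ` {0..vec (T + 1)})"
      by (intro compact_imp_bounded compact_continuous_image S T1) auto
    from uniform_limit_cmult[OF \<alpha>(1) A[OF T1] this]
    have "uniform_limit {0..vec (T + 1)} (\<lambda>r x. L x + \<alpha> r * ((A r x - L x) / \<alpha> r)) (\<lambda>x. L x + 0) at_top"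
      by (intro uniform_limit_add uniform_limit_const) simp
    moreover have "\<forall>\<^sub>F r in at_top. \<forall>x\<in>{0..vec (T + 1)}. L x + \<alpha> r * ((A r x - L x) / \<alpha> r) = A r x"
      using eventually_gt_at_top[of 0] by eventually_elim (use \<alpha>(2) in \<open>auto simp: less_imp_neq[symmetric]\<close>)
    ultimately show ?thesis by (subst (asm) uniform_limit_cong) auto
  qed
  have w_lim: "uniform_limit K w L at_top"
    unfolding w_def
    by (rule uniform_limit_compose_moving[OF A_lim _ y_lim y_in K1])
      (intro compact_uniformly_continuous continuous_on_subset[OF continuous], auto)
  have Q_lim: "uniform_limit K (\<lambda>r x. \<alpha> r / \<beta> r * Q r (y r x)) (\<lambda>x. a * S x) at_top"
  proof (rule uniform_limit_cmult[OF a])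
    show "uniform_limit K (\<lambda>r x. Q r (y r x)) S at_top"
      unfolding Q_def
      by (rule uniform_limit_compose_moving[OF A[OF T1] _ y_lim y_in K1])
        (intro compact_uniformly_continuous S T1, auto)
    have "bounded (S ` {0..vec T})"
      by (intro compact_imp_bounded compact_continuous_image S T) auto
    then show "bounded (S ` K)" by (rule bounded_subset) (use K in auto)
  qed
  define T' where "T' = CARD('n) * T + 1"
  have T': "0 < T'" using T by (simp add: T'_def add_pos_pos)
  have L_in: "L x \<in> {0..CARD('n) * T}" if "x \<in> K" for x
    using le_card_mult[of x T] K that by auto
  have w_in: "\<forall>\<^sub>F r in at_top. w r ` K \<subseteq> {0..T'}"
    using uniform_limitD[OF w_lim zero_less_one] y_in A_nonneg[OF T1]
  proof eventually_elim
    case (elim r)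
    show ?case
    proof
      fix v assume "v \<in> w r ` K"
      then obtain x where v: "v = w r x" and x: "x \<in> K" by auto
      have "dist v (L x) < 1" using elim x v by auto
      moreover have "0 \<le> v" using elim x unfolding v w_def by auto
      ultimately show "v \<in> {0..T'}" using L_in[OF x] by (simp add: T'_def dist_real_def) linarith
    qed
  qed
  have curve: "uniform_limit K (\<lambda>r x. 2 * r * (r * k (w r x / r) - w r x)) (\<lambda>x. \<sigma> * (L x)\<^sup>2) at_top"
  proof (rule uniform_limit_compose_moving[OF tangent_to_identity_uniform[OF k T'] _ w_lim w_in])
    show "uniformly_continuous_on {0..T'} (\<lambda>v. \<sigma> * v\<^sup>2)"
      by (intro compact_uniformly_continuous continuous_intros compact_Icc)
    show "L ` K \<subseteq> {0..T'}"
      unfolding T'_def using L_in by (intro image_subsetI) (smt (verit) atLeastAtMost_iff)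
  qed
  have bdd_L2: "bounded ((\<lambda>x. \<sigma> * (L x)\<^sup>2) ` K)"
  proof (rule bounded_subset)
    have "continuous_on {0..vec T} L" by (rule continuous_on_subset[OF continuous]) simp
    then show "bounded ((\<lambda>x. \<sigma> * (L x)\<^sup>2) ` {0..vec T})"
      by (intro compact_imp_bounded compact_continuous_image continuous_intros compact_Icc_vec)
  qed (use K in auto)
  have slope_bdd: "\<forall>\<^sub>F r in at_top. \<forall>x\<in>K. \<bar>square_slope L (- \<sigma>) r x\<bar> \<le> CARD('n) * T\<^sup>2"
    using eventually_ge_at_top[of T]
    by eventually_elim (use abs_square_slope_le \<sigma> T K in auto)
  have twice: "filterlim (\<lambda>r :: real. 2 * r) at_top at_top" by real_asymp
  have incr: "uniform_limit K (\<lambda>r x. 1 / (2 * r * \<beta> r) * (2 * r * (L (y r x) - L x))) (\<lambda>x. b * D x) at_top"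
  proof (cases "b = 0")
    case True
    \<comment> \<open>the slopes need not converge uniformly, but a vanishing factor times bounded slopes vanishes\<close>
    have "uniform_limit K (\<lambda>r x. 1 / (2 * r * \<beta> r) * (2 * r * (L (y r x) - L x) - square_slope L (- \<sigma>) (2 * r) x))
       (\<lambda>x. b * 0) at_top"
      unfolding y_def by (rule uniform_limit_cmult[OF b increment_uniform[OF k' T K]])
        (use \<sigma> in \<open>auto simp: image_constant_conv\<close>)
    moreover have "uniform_limit K (\<lambda>r x. 1 / (2 * r * \<beta> r) * square_slope L (- \<sigma>) (2 * r) x) (\<lambda>x. 0) at_top"
    proof (rule uniform_limit_null_comparison)
      have "((\<lambda>r. \<bar>1 / (2 * r * \<beta> r)\<bar> * (CARD('n) * T\<^sup>2)) \<longlongrightarrow> \<bar>0\<bar> * (CARD('n) * T\<^sup>2)) at_top"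
        using b True by (intro tendsto_intros) auto
      then show "uniform_limit K (\<lambda>r x. \<bar>1 / (2 * r * \<beta> r)\<bar> * (CARD('n) * T\<^sup>2)) (\<lambda>x. 0) at_top"
        using uniform_limit_of_tendsto by fastforce
      show "\<forall>\<^sub>F r in at_top. \<forall>x\<in>K. norm (1 / (2 * r * \<beta> r) * square_slope L (- \<sigma>) (2 * r) x)
          \<le> \<bar>1 / (2 * r * \<beta> r)\<bar> * (CARD('n) * T\<^sup>2)"
        using eventually_compose_filterlim[OF slope_bdd twice]
        by eventually_elim (auto simp only: real_norm_def abs_mult intro!: mult_left_mono abs_ge_zero)
    qed
    ultimately have "uniform_limit K (\<lambda>r x. 1 / (2 * r * \<beta> r) * (2 * r * (L (y r x) - L x) - square_slope L (- \<sigma>) (2 * r) x)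
       + 1 / (2 * r * \<beta> r) * square_slope L (- \<sigma>) (2 * r) x) (\<lambda>x. b * 0 + 0) at_top"
      by (rule uniform_limit_add)
    then show ?thesis using True by (simp only: flip: distrib_left) simp
  next
    case False
    then have D': "uniform_limit K (square_slope L (- \<sigma>)) D at_top" using D by auto
    have bdd_D: "bounded (D ` K)" using slope_limit_bounded[OF D' _ K] \<sigma> by simp
    have "uniform_limit K (\<lambda>r. square_slope L (- \<sigma>) (2 * r)) D at_top"
      by (rule filterlim_compose[OF D' twice])
    from uniform_limit_add[OF increment_uniform[OF k' T K] this] \<sigma>
    have "uniform_limit K (\<lambda>r x. 2 * r * (L (y r x) - L x)) D at_top"
      by (simp add: y_def)
    then show ?thesis by (rule uniform_limit_cmult[OF b _ bdd_D])
  qed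
  have "uniform_limit K (\<lambda>r x. 1 / (2 * r * \<beta> r) * (2 * r * (r * k (w r x / r) - w r x))
      + \<alpha> r / \<beta> r * Q r (y r x) + 1 / (2 * r * \<beta> r) * (2 * r * (L (y r x) - L x)))
      (\<lambda>x. b * (\<sigma> * (L x)\<^sup>2) + a * S x + b * D x) at_top"
    by (intro uniform_limit_add uniform_limit_cmult[OF b curve bdd_L2] Q_lim incr)
  moreover have "\<forall>\<^sub>F r in at_top. \<forall>x\<in>K. 1 / (2 * r * \<beta> r) * (2 * r * (r * k (w r x / r) - w r x))
      + \<alpha> r / \<beta> r * Q r (y r x) + 1 / (2 * r * \<beta> r) * (2 * r * (L (y r x) - L x)) = (B r x - L x) / \<beta> r"
    using B eventually_gt_at_top[of 0]
  proof (eventually_elim, intro ballI)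
    fix r x assume B: "\<forall>x\<in>K. B r x = r * k (A r (rescaled k' r x) / r)" and r: "0 < r" and x: "x \<in> K"
    have "B r x = r * k (w r x / r)" using B x by (simp add: w_def y_def)
    then show "1 / (2 * r * \<beta> r) * (2 * r * (r * k (w r x / r) - w r x))
      + \<alpha> r / \<beta> r * Q r (y r x) + 1 / (2 * r * \<beta> r) * (2 * r * (L (y r x) - L x)) = (B r x - L x) / \<beta> r"
      using r \<alpha>(2)[OF r] \<beta>[OF r] by (simp add: Q_def w_def field_simps)
  qed
  ultimately have "uniform_limit K (\<lambda>r x. (B r x - L x) / \<beta> r) (\<lambda>x. b * (\<sigma> * (L x)\<^sup>2) + a * S x + b * D x) at_top"
    by (subst (asm) uniform_limit_cong) auto
  then show ?thesis by (simp add: algebra_simps)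
qed

end

section \<open>Peaks over thresholds and block maxima\<close>

lemma copula_continuous: "copula C \<Longrightarrow> continuous_on X C"
  by (rule continuous_on_l1) (rule copula_le_plus)

lemma copula_pos:
  assumes "copula C" "(\<Sum>i\<in>UNIV. \<bar>1 - u $ i\<bar>) < 1"
  shows "0 < C u"
  using copula_le_plus[OF assms(1), of 1 u] copula_one[OF assms(1)] assms(2) by simp

lemma copula_zero_component:
  assumes "copula C" "u $ i = 0"
  shows "C u = 0"
  using copula_le_component[OF assms(1), of u i] copula_nonneg[OF assms(1), of u] assms(2) by simp

lemma vpowr_vexp_minus: "vpowr (vexp (- x)) (1 / r) = vexp (- (x /\<^sub>R r))"
  by (simp add: vpowr_vexp divide_inverse)

lemma vexp_continuous: "continuous_on X (vexp :: real ^ 'n \<Rightarrow> _)"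
  unfolding vexp_def by (intro continuous_intros)

text \<open>
  \<open>POT_rate\<close> and \<open>BM_rate\<close> are the two families \<open>F\<^sub>r\<close> and \<open>G\<^sub>r\<close> that converge to \<open>L\<close>. At a zero of the
  copula the convention \<open>ln 0 = 0\<close> gives \<open>BM_rate\<close> the value 0; on a bounded
  set of \<open>x\<close> this happens only for small \<open>r\<close>.
\<close>

definition POT_rate :: "(real ^ 'n \<Rightarrow> real) \<Rightarrow> real \<Rightarrow> real ^ 'n \<Rightarrow> real" where
  "POT_rate C r x = r * (1 - C (1 - x /\<^sub>R r))"

definition BM_value :: "(real ^ 'n \<Rightarrow> real) \<Rightarrow> real \<Rightarrow> real ^ 'n \<Rightarrow> real" where
  "BM_value C r x = C (vexp (- (x /\<^sub>R r))) powr r"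

definition BM_rate :: "(real ^ 'n \<Rightarrow> real) \<Rightarrow> real \<Rightarrow> real ^ 'n \<Rightarrow> real" where
  "BM_rate C r x = - ln (BM_value C r x)"

lemma BM_rate_eq: "BM_rate C r x = - (r * ln (C (vexp (- (x /\<^sub>R r)))))"
  by (cases "C (vexp (- (x /\<^sub>R r))) = 0") (simp_all add: BM_rate_def BM_value_def ln_powr)

text \<open>
  The substitution \<open>1 - y/r = e\<^sup>-\<^sup>x\<^sup>/\<^sup>r\<close> matches the arguments of the copula.
\<close>

lemma BM_rate_from_POT_rate:
  assumes "0 < r"
  shows "BM_rate C r x = r * - ln (1 - POT_rate C r (rescaled (\<lambda>s. 1 - exp (- s)) r x) / r)"
proof -
  have "1 - rescaled (\<lambda>s. 1 - exp (- s)) r x /\<^sub>R r = vexp (- (x /\<^sub>R r))"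
    using assms by (simp add: vec_eq_iff rescaled_def vexp_def divide_inverse mult.commute)
      (simp add: field_simps)
  then show ?thesis using assms by (simp add: BM_rate_eq POT_rate_def)
qed

lemma POT_rate_from_BM_rate:
  assumes "x \<in> {0..vec T}" "T < r" "0 < r" "0 < C (1 - x /\<^sub>R r)"
  shows "POT_rate C r x = r * (1 - exp (- (BM_rate C r (rescaled (\<lambda>s. - ln (1 - s)) r x) / r)))"
proof -
  have "x $ i < r" for i using assms(1,2) by (auto simp: less_eq_vec_def intro: le_less_trans)
  then have "vexp (- (rescaled (\<lambda>s. - ln (1 - s)) r x /\<^sub>R r)) = 1 - x /\<^sub>R r"
    using assms(3) by (simp add: vec_eq_iff rescaled_def vexp_def divide_inverse mult.commute)
      (simp add: field_simps)
  then show ?thesis using assms(3,4) by (simp add: BM_rate_eq POT_rate_def)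
qed

lemma l1_le_Icc:
  fixes x :: "real ^ 'n" and T r :: real
  assumes "x \<in> {0..vec T}" "CARD('n) * T < r" "0 < r"
  shows "(\<Sum>i\<in>UNIV. x $ i / r) < 1"
proof -
  have "(\<Sum>i\<in>UNIV. x $ i / r) \<le> (\<Sum>i\<in>(UNIV :: 'n set). T / r)"
    using assms by (intro sum_mono divide_right_mono) (auto simp: less_eq_vec_def)
  also have "\<dots> < 1" using assms by (simp add: field_simps)
  finally show ?thesis .
qed

text \<open>
  The copula is 1 at the vector 1 and Lipschitz, so it is positive near that vector.
\<close>

lemma copula_tail_pos:
  fixes C :: "real ^ 'n \<Rightarrow> real" and T r :: real
  assumes "copula C" "x \<in> {0..vec T}" "CARD('n) * T < r" "0 < r"
  shows "0 < C (1 - x /\<^sub>R r)" "0 < C (vexp (- (x /\<^sub>R r)))"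
proof -
  have x: "0 \<le> x $ i / r" for i using assms by (simp add: less_eq_vec_def)
  have "(\<Sum>i\<in>UNIV. \<bar>1 - (1 - x /\<^sub>R r) $ i\<bar>) = (\<Sum>i\<in>UNIV. x $ i / r)"
    using x by (intro sum.cong) (auto simp: divide_inverse mult.commute)
  then show "0 < C (1 - x /\<^sub>R r)"
    using l1_le_Icc[OF assms(2-4)] by (intro copula_pos[OF assms(1)]) simp
  have "(\<Sum>i\<in>UNIV. \<bar>1 - vexp (- (x /\<^sub>R r)) $ i\<bar>) \<le> (\<Sum>i\<in>UNIV. x $ i / r)"
  proof (intro sum_mono)
    fix i
    have "1 - x $ i / r \<le> exp (- (x $ i / r))" using exp_ge_add_one_self[of "- (x $ i / r)"] by simp
    moreover have "exp (- (x $ i / r)) \<le> 1" using x by simp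
    ultimately show "\<bar>1 - vexp (- (x /\<^sub>R r)) $ i\<bar> \<le> x $ i / r"
      by (simp add: vexp_def divide_inverse mult.commute)
  qed
  then show "0 < C (vexp (- (x /\<^sub>R r)))"
    using l1_le_Icc[OF assms(2-4)] by (intro copula_pos[OF assms(1)]) simp
qed

lemma vec_Icc_ln:
  fixes u :: "real ^ 'n"
  assumes "u \<in> {vec \<delta>..1}" "0 < \<delta>" "- ln \<delta> \<le> T"
  shows "(\<chi> i. - ln (u $ i)) \<in> {0..vec T}"
proof -
  have "\<delta> \<le> u $ i" "u $ i \<le> 1" for i using assms by (auto simp: less_eq_vec_def)
  moreover from this have "0 < u $ i" for i using assms(2) less_le_trans by blast
  ultimately have "ln \<delta> \<le> ln (u $ i)" "ln (u $ i) \<le> 0" for i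
    using assms(2) by simp_all
  then show ?thesis using assms(3) by (auto simp: less_eq_vec_def) (smt (verit))
qed

lemma vexp_ln: "(\<And>i. 0 < u $ i) \<Longrightarrow> vexp (- (\<chi> i. - ln (u $ i))) = u"
  by (simp add: vexp_def vec_eq_iff)

text \<open>
  The setting of the second order conditions. Each of them contains the convergence of its family
  to \<open>L\<close>, at the rate that it prescribes.
\<close>

locale tail_copula = stable_tail L for L :: "real ^ 'n \<Rightarrow> real" +
  fixes C Cinf :: "real ^ 'n \<Rightarrow> real"
  assumes C: "copula C" and Cinf: "copula Cinf"
    and Cinf_vexp: "0 \<le> x \<Longrightarrow> Cinf (vexp (- x)) = exp (- L x)"
begin

lemma POT_second_order_iff:
  "POT_second_order C L \<alpha> S \<longleftrightarrow>
     (\<forall>t>0. 0 < \<alpha> t) \<and> (\<alpha> \<longlongrightarrow> 0) at_top \<and> (\<exists>x\<ge>0. S x \<noteq> 0) \<and>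
     (\<forall>T>0. uniform_limit {0..vec T} (\<lambda>r x. (POT_rate C r x - L x) / \<alpha> r) S at_top)"
proof -
  have "((\<lambda>t. (POT_rate C t x - L x) / \<alpha> t) \<longlongrightarrow> S x) at_top"
    if U: "\<forall>T>0. uniform_limit {0..vec T} (\<lambda>r x. (POT_rate C r x - L x) / \<alpha> r) S at_top" and x: "0 \<le> x" for x
  proof -
    have "uniform_limit {0..vec (norm x + 1)} (\<lambda>r x. (POT_rate C r x - L x) / \<alpha> r) S at_top"
      using U by (simp add: add_nonneg_pos)
    from tendsto_uniform_limitI[OF this in_Icc_norm[OF x]] show ?thesis .
  qed
  then show ?thesis
    unfolding POT_second_order_def POT_rate_def[symmetric] by (auto simp: Bex_def Ball_def)
qed

text \<open>
  The substitution \<open>u = e\<^sup>-\<^sup>x\<close> maps boxes \<open>[0,T]\<^sup>d\<close> onto boxes \<open>[e\<^sup>-\<^sup>T,1]\<^sup>d\<close>. Points \<open>u\<close> with a zero component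
  are not reached, but there all values are 0.
\<close>

lemma BM_second_orderI:
  assumes \<beta>: "\<And>r. 0 < r \<Longrightarrow> 0 < \<beta> r" "(\<beta> \<longlongrightarrow> 0) at_top" and nz: "\<exists>x\<ge>0. g x \<noteq> 0"
    and U: "\<And>T. 0 < T \<Longrightarrow> uniform_limit {0..vec T} (\<lambda>r x. (BM_value C r x - exp (- L x)) / \<beta> r) g at_top"
  shows "BM_second_order C Cinf \<beta> (of_neg_log g)"
proof -
  let ?Q = "\<lambda>r u. (C (vpowr u (1 / r)) powr r - Cinf u) / \<beta> r"
  let ?x = "\<lambda>u :: real ^ 'n. \<chi> i. - ln (u $ i)"
  have unif: "uniform_limit {vec \<delta>..1} ?Q (of_neg_log g) at_top" if \<delta>: "0 < \<delta>" for \<delta>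
  proof -
    define T where "T = max 1 (- ln \<delta>)"
    have "0 < T" "- ln \<delta> \<le> T" by (auto simp: T_def)
    then have x: "?x u \<in> {0..vec T}" if "u \<in> {vec \<delta>..1}" for u
      using vec_Icc_ln[OF that \<delta>] by simp
    have "uniform_limit {vec \<delta>..1} (\<lambda>r u. (BM_value C r (?x u) - exp (- L (?x u))) / \<beta> r) (\<lambda>u. g (?x u)) at_top"
      by (rule uniform_limit_compose'[OF U[OF \<open>0 < T\<close>]]) (use x in auto)
    moreover have "(BM_value C r (?x u) - exp (- L (?x u))) / \<beta> r = ?Q r u \<and> g (?x u) = of_neg_log g u"
      if u: "u \<in> {vec \<delta>..1}" for r u
    proof -
      have pos: "0 < u $ i" for i using u \<delta> by (auto simp: less_eq_vec_def intro: less_le_trans)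
      then have "vexp (- ?x u) = u" by (rule vexp_ln)
      then show ?thesis
        using pos Cinf_vexp[of "?x u"] x[OF u] vpowr_vexp_minus[of "?x u" r]
        by (simp add: BM_value_def of_neg_log_def)
    qed
    ultimately show ?thesis by (subst uniform_limit_cong'[symmetric]) auto
  qed
  have ptw: "((\<lambda>r. ?Q r u) \<longlongrightarrow> of_neg_log g u) at_top" if u: "u \<in> {0..1}" for u
  proof (cases "\<forall>i. 0 < u $ i")
    case True
    define \<delta> where "\<delta> = Min (range (\<lambda>i. u $ i))"
    have "0 < \<delta>" using True by (simp add: \<delta>_def)
    moreover have "u \<in> {vec \<delta>..1}" using u by (simp add: less_eq_vec_def \<delta>_def)
    ultimately show ?thesis using tendsto_uniform_limitI[OF unif] by blast
  next
    case False
    then obtain i where i: "u $ i = 0" using u by (auto simp: less_eq_vec_def not_less intro: antisym)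
    have Q0: "?Q r u = 0" for r
      using copula_zero_component[OF Cinf i] copula_zero_component[OF C, of "vpowr u (1 / r)" i] i
      by (simp add: vpowr_def)
    have "of_neg_log g u = 0" using False by (auto simp: of_neg_log_def)
    then show ?thesis by (simp only: Q0 tendsto_const)
  qed
  obtain x where x: "0 \<le> x" "g x \<noteq> 0" using nz by auto
  have "of_neg_log g (vexp (- x)) \<noteq> 0" using x by (simp add: of_neg_log_vexp)
  moreover have "vexp (- x) \<in> {0..1}" using x by (simp add: less_eq_vec_def vexp_def)
  ultimately have "\<exists>u\<in>{0..1}. of_neg_log g u \<noteq> 0" by blast
  then show ?thesis
    unfolding BM_second_order_def using \<beta> unif ptw by auto
qed

lemma BM_second_orderD:
  assumes "BM_second_order C Cinf \<alpha> S"
  shows "0 < r \<Longrightarrow> 0 < \<alpha> r" "(\<alpha> \<longlongrightarrow> 0) at_top" "\<exists>x\<ge>0. S (vexp (- x)) \<noteq> 0"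
    "0 < T \<Longrightarrow> uniform_limit {0..vec T} (\<lambda>r x. (BM_value C r x - exp (- L x)) / \<alpha> r) (\<lambda>x. S (vexp (- x))) at_top"
proof -
  let ?Q = "\<lambda>r u. (C (vpowr u (1 / r)) powr r - Cinf u) / \<alpha> r"
  show "0 < r \<Longrightarrow> 0 < \<alpha> r" "(\<alpha> \<longlongrightarrow> 0) at_top"
    using assms by (auto simp: BM_second_order_def)
  obtain u where u: "u \<in> {0..1}" "S u \<noteq> 0" using assms by (auto simp: BM_second_order_def)
  have "((\<lambda>r. ?Q r u) \<longlongrightarrow> S u) at_top" using assms u by (auto simp: BM_second_order_def)
  have pos: "0 < u $ i" for i
  proof (rule ccontr)
    assume "\<not> 0 < u $ i"
    then have i: "u $ i = 0" using u by (auto simp: less_eq_vec_def not_less intro: antisym)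
    have "?Q r u = 0" for r
      using copula_zero_component[OF Cinf i] copula_zero_component[OF C, of "vpowr u (1 / r)" i] i
      by (simp add: vpowr_def)
    then have "((\<lambda>r. ?Q r u) \<longlongrightarrow> 0) at_top" by (simp only: tendsto_const)
    from tendsto_unique[OF _ this \<open>((\<lambda>r. ?Q r u) \<longlongrightarrow> S u) at_top\<close>] show False
      using u(2) by simp
  qed
  show "\<exists>x\<ge>0. S (vexp (- x)) \<noteq> 0"
    by (rule exI[of _ "\<chi> i. - ln (u $ i)"])
      (use u pos vexp_ln[of u] in \<open>auto simp: less_eq_vec_def ln_le_zero_iff\<close>)
  show "uniform_limit {0..vec T} (\<lambda>r x. (BM_value C r x - exp (- L x)) / \<alpha> r) (\<lambda>x. S (vexp (- x))) at_top"
    if "0 < T"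
  proof -
    have U: "uniform_limit {vec (exp (- T))..1} ?Q S at_top"
      using assms by (simp add: BM_second_order_def)
    have "(\<lambda>x :: real ^ 'n. vexp (- x)) \<in> {0..vec T} \<rightarrow> {vec (exp (- T))..1}"
      by (auto simp: less_eq_vec_def vexp_def)
    from uniform_limit_compose'[OF U this]
    have "uniform_limit {0..vec T} (\<lambda>r x. ?Q r (vexp (- x))) (\<lambda>x. S (vexp (- x))) at_top" .
    moreover have "?Q r (vexp (- x)) = (BM_value C r x - exp (- L x)) / \<alpha> r" if "x \<in> {0..vec T}" for r x
      using that Cinf_vexp[of x] by (simp add: vpowr_vexp_minus BM_value_def)
    ultimately show ?thesis by (subst uniform_limit_cong'[symmetric]) auto
  qed
qed

lemma POT_limit_continuous:
  assumes "uniform_limit {0..vec T} (\<lambda>r x. (POT_rate C r x - L x) / \<alpha> r) S at_top"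
  shows "continuous_on {0..vec T} S"
proof (rule uniform_limit_theorem[OF always_eventually assms])
  have "continuous_on {0..vec T} (\<lambda>x. C (1 - x /\<^sub>R r))" for r
    by (rule continuous_on_compose2[OF copula_continuous[OF C, of UNIV]]) (auto intro!: continuous_intros)
  moreover have "continuous_on {0..vec T} L" by (rule continuous_on_subset[OF continuous]) simp
  ultimately show "\<forall>r. continuous_on {0..vec T} (\<lambda>x. (POT_rate C r x - L x) / \<alpha> r)"
    unfolding POT_rate_def divide_inverse by (intro allI continuous_intros)
qed simp

lemma BM_limit_continuous:
  assumes "uniform_limit {0..vec T} (\<lambda>r x. (BM_value C r x - exp (- L x)) / \<alpha> r) S at_top"
  shows "continuous_on {0..vec T} S"
proof (rule uniform_limit_theorem[OF _ assms])
  have L: "continuous_on {0..vec T} L" by (rule continuous_on_subset[OF continuous]) simp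
  show "\<forall>\<^sub>F r in at_top. continuous_on {0..vec T} (\<lambda>x. (BM_value C r x - exp (- L x)) / \<alpha> r)"
    using eventually_gt_at_top[of 0]
  proof eventually_elim
    case (elim r)
    have "continuous_on {0..vec T} (\<lambda>x. vexp (- (x /\<^sub>R r)))"
      by (rule continuous_on_compose2[OF vexp_continuous[of UNIV]]) (auto intro!: continuous_intros)
    then have "continuous_on {0..vec T} (\<lambda>x. C (vexp (- (x /\<^sub>R r))))"
      by (rule continuous_on_compose2[OF copula_continuous[OF C, of UNIV]]) auto
    then have "continuous_on {0..vec T} (\<lambda>x. BM_value C r x)"
      unfolding BM_value_def using elim copula_nonneg[OF C]
      by (intro continuous_on_powr') (auto intro!: continuous_intros)
    then show ?case using L unfolding divide_inverse by (intro continuous_intros)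
  qed
qed simp

text \<open>
  The change of scale gives an expansion of \<open>BM_rate\<close>, and \<open>v \<mapsto> exp (- v)\<close> carries it to \<open>BM_value\<close>.
\<close>

lemma BM_limit_from_POT:
  assumes POT: "POT_second_order C L \<alpha> S" and \<beta>: "\<And>r. 0 < r \<Longrightarrow> 0 < \<beta> r" "(\<beta> \<longlongrightarrow> 0) at_top"
    and a: "((\<lambda>r. \<alpha> r / \<beta> r) \<longlongrightarrow> a) at_top" and b: "((\<lambda>r. 1 / (2 * r * \<beta> r)) \<longlongrightarrow> b) at_top"
    and T: "0 < T" and K: "K \<subseteq> {0..vec T}"
    and D: "b = 0 \<or> uniform_limit K (square_slope L (- 1)) (\<lambda>x. - Gamma2 L x) at_top"
  shows "uniform_limit K (\<lambda>r x. (BM_value C r x - exp (- L x)) / \<beta> r)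
     (\<lambda>x. exp (- L x) * (b * (Gamma2 L x - (L x)\<^sup>2) - a * S x)) at_top"
proof -
  have U: "\<And>T. 0 < T \<Longrightarrow> uniform_limit {0..vec T} (\<lambda>r x. (POT_rate C r x - L x) / \<alpha> r) S at_top"
    and \<alpha>: "(\<alpha> \<longlongrightarrow> 0) at_top" "\<And>r. 0 < r \<Longrightarrow> 0 < \<alpha> r"
    using POT by (auto simp: POT_second_order_iff)
  have S: "continuous_on {0..vec T} S" if "0 < T" for T
    by (rule POT_limit_continuous[OF U[OF that]])
  have nonneg_rate: "\<forall>\<^sub>F r in at_top. \<forall>x\<in>{0..vec T}. 0 \<le> POT_rate C r x" if "0 < T" for T
    using eventually_gt_at_top[of 0]
  proof (eventually_elim, intro ballI)
    fix r :: real and x :: "real ^ 'n" assume "0 < r" "x \<in> {0..vec T}"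
    then have "C (1 - x /\<^sub>R r) \<le> C 1"
      by (intro copula_mono[OF C]) (simp add: less_eq_vec_def)
    then show "0 \<le> POT_rate C r x" using \<open>0 < r\<close> copula_one[OF C] by (simp add: POT_rate_def)
  qed
  have rate: "uniform_limit K (\<lambda>r x. (BM_rate C r x - L x) / \<beta> r)
      (\<lambda>x. a * S x + b * (1 * (L x)\<^sup>2 + - Gamma2 L x)) at_top"
  proof (rule second_order_change_of_scale[OF tangent_to_identity_ln tangent_to_identity_exp _
        U nonneg_rate S \<alpha> \<beta>(1) T K _ a b])
    show "\<forall>\<^sub>F r in at_top. \<forall>x\<in>K. BM_rate C r x
        = r * - ln (1 - POT_rate C r (rescaled (\<lambda>s. 1 - exp (- s)) r x) / r)"
      using eventually_gt_at_top[of 0] by eventually_elim (simp add: BM_rate_from_POT_rate)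
  qed (use D in auto)
  have SK: "bounded (S ` K)"
    by (rule bounded_subset[of "S ` {0..vec T}"])
      (use K S[OF T] in \<open>auto intro!: compact_imp_bounded compact_continuous_image\<close>)
  have bdd: "bounded ((\<lambda>x. a * S x + b * (1 * (L x)\<^sup>2 + - Gamma2 L x)) ` K)"
    by (rule bounded_second_order_limit[OF SK K]) (use D in auto)
  have "uniform_limit K (\<lambda>r x. (exp (- BM_rate C r x) - exp (- L x)) / \<beta> r)
      (\<lambda>x. - exp (- L x) * (a * S x + b * (1 * (L x)\<^sup>2 + - Gamma2 L x))) at_top"
  proof (rule uniform_limit_difference_quotient[OF rate \<beta>(2) _ bdd])
    show "L ` K \<subseteq> {-1 + 1..(CARD('n) * T + 1) - 1}" using le_card_mult[OF subsetD[OF K]] by auto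
    show "((\<lambda>v. exp (- v)) has_real_derivative - exp (- v)) (at v)" for v :: real
      by (auto intro!: derivative_eq_intros)
    show "\<forall>\<^sub>F r in at_top. \<beta> r \<noteq> 0"
      using eventually_gt_at_top[of 0] by eventually_elim (use \<beta>(1) in force)
  qed (auto intro!: continuous_intros)
  moreover have "\<forall>\<^sub>F r in at_top. \<forall>x\<in>K. (exp (- BM_rate C r x) - exp (- L x)) / \<beta> r
      = (BM_value C r x - exp (- L x)) / \<beta> r"
    using eventually_gt_at_top[of "CARD('n) * T"] eventually_gt_at_top[of 0]
  proof (eventually_elim, intro ballI)
    fix r x assume "CARD('n) * T < r" "0 < r" "x \<in> K"
    then have "0 < BM_value C r x"
      using copula_tail_pos(2)[OF C, of x T r] K by (auto simp: BM_value_def)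
    then show "(exp (- BM_rate C r x) - exp (- L x)) / \<beta> r = (BM_value C r x - exp (- L x)) / \<beta> r"
      by (simp add: BM_rate_def)
  qed
  ultimately have "uniform_limit K (\<lambda>r x. (BM_value C r x - exp (- L x)) / \<beta> r)
      (\<lambda>x. - exp (- L x) * (a * S x + b * (1 * (L x)\<^sup>2 + - Gamma2 L x))) at_top"
    by (subst (asm) uniform_limit_cong) auto
  then show ?thesis by (simp add: algebra_simps)
qed

text \<open>
  The mirror image: \<open>v \<mapsto> - ln v\<close> turns the hypothesis into an expansion of \<open>BM_rate\<close>, to which the
  change of scale with \<open>\<sigma> = -1\<close> applies.
\<close>

lemma POT_limit_from_BM:
  assumes BM: "BM_second_order C Cinf \<alpha> S" and \<beta>: "\<And>r. 0 < r \<Longrightarrow> 0 < \<beta> r"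
    and a: "((\<lambda>r. \<alpha> r / \<beta> r) \<longlongrightarrow> a) at_top" and b: "((\<lambda>r. 1 / (2 * r * \<beta> r)) \<longlongrightarrow> b) at_top"
    and T: "0 < T" and K: "K \<subseteq> {0..vec T}"
    and D: "b = 0 \<or> uniform_limit K (square_slope L 1) (Gamma1 L) at_top"
  shows "uniform_limit K (\<lambda>r x. (POT_rate C r x - L x) / \<beta> r)
     (\<lambda>x. b * (Gamma1 L x - (L x)\<^sup>2) - a * (S (vexp (- x)) / exp (- L x))) at_top"
proof -
  note BMD = BM_second_orderD[OF BM]
  have S: "continuous_on {0..vec T} (\<lambda>x. S (vexp (- x)))" if "0 < T" for T
    by (rule BM_limit_continuous[OF BMD(4)[OF that]])
  have L: "continuous_on {0..vec T} L" for T by (rule continuous_on_subset[OF continuous]) simp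
  define S' where "S' x = - inverse (exp (- L x)) * S (vexp (- x))" for x
  have U: "uniform_limit {0..vec T} (\<lambda>r x. (BM_rate C r x - L x) / \<alpha> r) S' at_top" if T: "0 < T" for T
  proof -
    \<comment> \<open>a positive lower bound of \<open>exp (- L x)\<close>, which keeps the logarithm away from 0\<close>
    let ?m = "exp (- (CARD('n) * T))"
    have "uniform_limit {0..vec T} (\<lambda>r x. (- ln (BM_value C r x) - - ln (exp (- L x))) / \<alpha> r)
        (\<lambda>x. - inverse (exp (- L x)) * S (vexp (- x))) at_top"
    proof (rule uniform_limit_difference_quotient[OF BMD(4)[OF T] BMD(2)])
      show "(\<lambda>x. exp (- L x)) ` {0..vec T} \<subseteq> {?m / 2 + ?m / 2..(1 + ?m / 2) - ?m / 2}"
      proof (rule image_subsetI)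
        fix x :: "real ^ 'n" assume "x \<in> {0..vec T}"
        from le_card_mult[OF this] have "?m \<le> exp (- L x)" "exp (- L x) \<le> 1" by simp_all
        then show "exp (- L x) \<in> {?m / 2 + ?m / 2..(1 + ?m / 2) - ?m / 2}" by simp
      qed
      show "bounded ((\<lambda>x. S (vexp (- x))) ` {0..vec T})"
        by (intro compact_imp_bounded compact_continuous_image S T) simp
      have pos: "0 < v" if "v \<in> {?m / 2..1 + ?m / 2}" for v
        by (rule less_le_trans[of 0 "?m / 2"]) (use that in simp_all)
      show "((\<lambda>v. - ln v) has_real_derivative - inverse v) (at v)" if "v \<in> {?m / 2..1 + ?m / 2}" for v
        using pos[OF that] by (auto intro!: derivative_eq_intros simp: divide_inverse)
      show "continuous_on {?m / 2..1 + ?m / 2} (\<lambda>v. - inverse v)"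
      proof (intro continuous_intros ballI)
        fix v assume "v \<in> {?m / 2..1 + ?m / 2}"
        from pos[OF this] show "v \<noteq> 0" by simp
      qed
      show "\<forall>\<^sub>F r in at_top. \<alpha> r \<noteq> 0"
        using eventually_gt_at_top[of 0] by eventually_elim (use BMD(1) in force)
      show "0 < ?m / 2" by simp
    qed
    then show ?thesis by (simp add: BM_rate_def S'_def[abs_def])
  qed
  have S': "continuous_on {0..vec T} S'" if "0 < T" for T
    unfolding S'_def using S[OF that] L by (intro continuous_intros) auto
  have nonneg_rate: "\<forall>\<^sub>F r in at_top. \<forall>x\<in>{0..vec T}. 0 \<le> BM_rate C r x" if "0 < T" for T
    using eventually_gt_at_top[of 0]
  proof (eventually_elim, intro ballI)
    fix r :: real and x :: "real ^ 'n" assume "0 < r" "x \<in> {0..vec T}"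
    then have "C (vexp (- (x /\<^sub>R r))) \<le> C 1"
      by (intro copula_mono[OF C]) (simp add: less_eq_vec_def vexp_def)
    then have "ln (C (vexp (- (x /\<^sub>R r)))) \<le> 0"
      using copula_one[OF C] copula_nonneg[OF C, of "vexp (- (x /\<^sub>R r))"]
      by (cases "C (vexp (- (x /\<^sub>R r))) = 0") (auto simp: ln_le_zero_iff)
    then show "0 \<le> BM_rate C r x"
      using \<open>0 < r\<close> by (simp add: BM_rate_eq mult_nonneg_nonpos)
  qed
  have "uniform_limit K (\<lambda>r x. (POT_rate C r x - L x) / \<beta> r)
      (\<lambda>x. a * S' x + b * (- 1 * (L x)\<^sup>2 + Gamma1 L x)) at_top"
  proof (rule second_order_change_of_scale[OF tangent_to_identity_exp _ _
        U nonneg_rate S' BMD(2) BMD(1) \<beta> T K _ a b])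
    show "\<forall>\<^sub>F r in at_top. \<forall>x\<in>K. POT_rate C r x
        = r * (1 - exp (- (BM_rate C r (rescaled (\<lambda>s. - ln (1 - s)) r x) / r)))"
      using eventually_gt_at_top[of "CARD('n) * T"] eventually_gt_at_top[of T] eventually_gt_at_top[of 0]
    proof (eventually_elim, intro ballI)
      fix r x assume r: "CARD('n) * T < r" "T < r" "0 < r" and "x \<in> K"
      then have x: "x \<in> {0..vec T}" using K by auto
      show "POT_rate C r x = r * (1 - exp (- (BM_rate C r (rescaled (\<lambda>s. - ln (1 - s)) r x) / r)))"
        by (rule POT_rate_from_BM_rate[where T = T]) (use x r copula_tail_pos(1)[OF C x r(1,3)] in auto)
    qed
    show "tangent_to_identity (- (- 1)) (\<lambda>s. - ln (1 - s))" using tangent_to_identity_ln by simp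
    show "b = 0 \<or> uniform_limit K (square_slope L (- (- 1))) (Gamma1 L) at_top" using D by simp
  qed simp
  then show ?thesis by (simp add: S'_def divide_inverse algebra_simps)
qed

lemma Gamma1_slope_uniform:
  "\<lbrakk>continuous_on {0..} (Gamma1 L); 0 < T\<rbrakk> \<Longrightarrow> uniform_limit {0..vec T} (square_slope L 1) (Gamma1 L) at_top"
  by (rule square_slope_uniform) (auto intro: Gamma1_tendsto)

lemma Gamma2_slope_uniform:
  "\<lbrakk>continuous_on {0..} (Gamma2 L); 0 < T\<rbrakk> \<Longrightarrow>
    uniform_limit {0..vec T} (square_slope L (- 1)) (\<lambda>x. - Gamma2 L x) at_top"
  by (rule square_slope_uniform) (auto intro: Gamma2_tendsto continuous_intros)

lemma BM_from_POT:
  assumes POT: "POT_second_order C L \<alpha> S" and \<beta>: "\<And>r. 0 < r \<Longrightarrow> 0 < \<beta> r" "(\<beta> \<longlongrightarrow> 0) at_top"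
    and a: "((\<lambda>r. \<alpha> r / \<beta> r) \<longlongrightarrow> a) at_top" and b: "((\<lambda>r. 1 / (2 * r * \<beta> r)) \<longlongrightarrow> b) at_top"
    and D: "b = 0 \<or> continuous_on {0..} (Gamma2 L)"
    and g: "\<And>x. 0 \<le> x \<Longrightarrow> g x = exp (- L x) * (b * (Gamma2 L x - (L x)\<^sup>2) - a * S x)"
    and nz: "\<exists>x\<ge>0. g x \<noteq> 0"
  shows "BM_second_order C Cinf \<beta> (of_neg_log g)"
proof (rule BM_second_orderI[OF \<beta> nz])
  fix T :: real assume T: "0 < T"
  have "uniform_limit {0..vec T} (\<lambda>r x. (BM_value C r x - exp (- L x)) / \<beta> r)
     (\<lambda>x. exp (- L x) * (b * (Gamma2 L x - (L x)\<^sup>2) - a * S x)) at_top"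
    by (rule BM_limit_from_POT[OF POT \<beta> a b T order_refl]) (use D Gamma2_slope_uniform T in auto)
  then show "uniform_limit {0..vec T} (\<lambda>r x. (BM_value C r x - exp (- L x)) / \<beta> r) g at_top"
    by (subst uniform_limit_cong') (use g in auto)
qed

lemma POT_from_BM:
  assumes BM: "BM_second_order C Cinf \<alpha> S" and \<beta>: "\<And>r. 0 < r \<Longrightarrow> 0 < \<beta> r" "(\<beta> \<longlongrightarrow> 0) at_top"
    and a: "((\<lambda>r. \<alpha> r / \<beta> r) \<longlongrightarrow> a) at_top" and b: "((\<lambda>r. 1 / (2 * r * \<beta> r)) \<longlongrightarrow> b) at_top"
    and D: "b = 0 \<or> continuous_on {0..} (Gamma1 L)"
    and g: "\<And>x. 0 \<le> x \<Longrightarrow> g x = b * (Gamma1 L x - (L x)\<^sup>2) - a * (S (vexp (- x)) / exp (- L x))"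
    and nz: "\<exists>x\<ge>0. g x \<noteq> 0"
  shows "POT_second_order C L \<beta> g"
  unfolding POT_second_order_iff
proof (intro conjI allI impI \<beta> nz)
  fix T :: real assume T: "0 < T"
  have "uniform_limit {0..vec T} (\<lambda>r x. (POT_rate C r x - L x) / \<beta> r)
     (\<lambda>x. b * (Gamma1 L x - (L x)\<^sup>2) - a * (S (vexp (- x)) / exp (- L x))) at_top"
    by (rule POT_limit_from_BM[OF BM \<beta>(1) a b T order_refl]) (use D Gamma1_slope_uniform T in auto)
  then show "uniform_limit {0..vec T} (\<lambda>r x. (POT_rate C r x - L x) / \<beta> r) g at_top"
    by (subst uniform_limit_cong') (use g in auto)
qed

lemma half_rate:
  "0 < r \<Longrightarrow> 0 < 1 / (2 * r)" "((\<lambda>r::real. 1 / (2 * r)) \<longlongrightarrow> 0) at_top"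
  "((\<lambda>r::real. 1 / (2 * r * (1 / (2 * r)))) \<longlongrightarrow> 1) at_top" for r :: real
  by (simp, real_asymp+)

text \<open>
  When \<open>2 r \<alpha> r\<close> tends to 0, the differences multiplied by \<open>2 r\<close> converge pointwise whether or not
  \<open>Gamma2\<close> is continuous; a second order condition with any rate then forces continuity.
\<close>

lemma Gamma2_continuous_of_BM:
  assumes POT: "POT_second_order C L \<alpha> S" and small: "((\<lambda>r. 2 * r * \<alpha> r) \<longlongrightarrow> 0) at_top"
    and BM: "BM_second_order C Cinf \<alpha>' S'"
  shows "continuous_on {0..} (Gamma2 L)"
proof -
  note BMD = BM_second_orderD[OF BM]
  have a: "((\<lambda>r. \<alpha> r / (1 / (2 * r))) \<longlongrightarrow> 0) at_top" using small by (simp add: mult.commute)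
  obtain x0 where x0: "0 \<le> x0" "S' (vexp (- x0)) \<noteq> 0" using BMD(3) by blast
  have lim: "((\<lambda>r. 2 * r * (BM_value C r x - exp (- L x))) \<longlongrightarrow> exp (- L x) * (Gamma2 L x - (L x)\<^sup>2)) at_top"
    if x: "0 \<le> x" for x
  proof -
    have "uniform_limit {x} (\<lambda>r x. (BM_value C r x - exp (- L x)) / (1 / (2 * r)))
       (\<lambda>x. exp (- L x) * (1 * (Gamma2 L x - (L x)\<^sup>2) - 0 * S x)) at_top"
      by (rule BM_limit_from_POT[OF POT half_rate(1,2) a half_rate(3), of "norm x + 1"])
        (use in_Icc_norm[OF x] Gamma2_tendsto[OF x] in \<open>auto simp: add_nonneg_pos\<close>)
    then show ?thesis by (simp add: mult.commute)
  qed
  have cont: "continuous_on {0..} (\<lambda>x. exp (- L x) * (Gamma2 L x - (L x)\<^sup>2))"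
    by (rule pointwise_limit_continuous_of_uniform_ratio[OF BMD(4) BM_limit_continuous[OF BMD(4)] BMD(1) x0 lim])
  have "continuous_on {0..} (\<lambda>x. exp (L x) * (exp (- L x) * (Gamma2 L x - (L x)\<^sup>2)) + (L x)\<^sup>2)"
    by (rule continuous_on_add[OF continuous_on_mult[OF _ cont]]) (intro continuous_intros continuous)+
  moreover have "exp (L x) * (exp (- L x) * (Gamma2 L x - (L x)\<^sup>2)) + (L x)\<^sup>2 = Gamma2 L x" for x
    by (simp add: mult.assoc[symmetric] flip: exp_add)
  ultimately show ?thesis by simp
qed

lemma Gamma1_continuous_of_POT:
  assumes BM: "BM_second_order C Cinf \<alpha> S" and small: "((\<lambda>r. 2 * r * \<alpha> r) \<longlongrightarrow> 0) at_top"
    and POT: "POT_second_order C L \<alpha>' S'"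
  shows "continuous_on {0..} (Gamma1 L)"
proof -
  have U: "\<And>T. 0 < T \<Longrightarrow> uniform_limit {0..vec T} (\<lambda>r x. (POT_rate C r x - L x) / \<alpha>' r) S' at_top"
    and \<alpha>': "\<And>r. 0 < r \<Longrightarrow> 0 < \<alpha>' r" and nz: "\<exists>x\<ge>0. S' x \<noteq> 0"
    using POT by (auto simp: POT_second_order_iff)
  have a: "((\<lambda>r. \<alpha> r / (1 / (2 * r))) \<longlongrightarrow> 0) at_top" using small by (simp add: mult.commute)
  obtain x0 where x0: "0 \<le> x0" "S' x0 \<noteq> 0" using nz by blast
  have lim: "((\<lambda>r. 2 * r * (POT_rate C r x - L x)) \<longlongrightarrow> Gamma1 L x - (L x)\<^sup>2) at_top" if x: "0 \<le> x" for x
  proof -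
    have "uniform_limit {x} (\<lambda>r x. (POT_rate C r x - L x) / (1 / (2 * r)))
       (\<lambda>x. 1 * (Gamma1 L x - (L x)\<^sup>2) - 0 * (S (vexp (- x)) / exp (- L x))) at_top"
      by (rule POT_limit_from_BM[OF BM half_rate(1) a half_rate(3), of "norm x + 1"])
        (use in_Icc_norm[OF x] Gamma1_tendsto[OF x] in \<open>auto simp: add_nonneg_pos\<close>)
    then show ?thesis by (simp add: mult.commute)
  qed
  have cont: "continuous_on {0..} (\<lambda>x. Gamma1 L x - (L x)\<^sup>2)"
    by (rule pointwise_limit_continuous_of_uniform_ratio[OF U POT_limit_continuous[OF U] \<alpha>' x0 lim])
  have "continuous_on {0..} (\<lambda>x. Gamma1 L x - (L x)\<^sup>2 + (L x)\<^sup>2)"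
    by (rule continuous_on_add[OF cont]) (intro continuous_intros continuous)
  then show ?thesis by simp
qed

lemma one_less_L_one:
  assumes "\<exists>x\<in>{0..}. L x \<noteq> L_max x"
  shows "1 < L 1"
proof -
  have "1 \<le> L 1" using component_le[of 1 undefined] by (simp add: less_eq_vec_def)
  moreover have "L 1 \<noteq> 1" using assms eq_L_max_of_one by auto
  ultimately show ?thesis by simp
qed

end

text \<open>
  Multiplied by \<open>2r\<close>, the sum \<open>\<alpha> r + 1/(2r)\<close> tends to \<open>1 + c\<close>.
\<close>

lemma weights_of_ratio_limit:
  fixes \<alpha> :: "real \<Rightarrow> real"
  assumes c: "((\<lambda>r. 2 * r * \<alpha> r) \<longlongrightarrow> c) at_top" "0 \<le> c" and \<alpha>: "\<And>r. 0 < r \<Longrightarrow> 0 < \<alpha> r"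
  shows "((\<lambda>r. \<alpha> r / (\<alpha> r + 1 / (2 * r))) \<longlongrightarrow> 1 - 1 / (1 + c)) at_top"
    and "((\<lambda>r. 1 / (2 * r * (\<alpha> r + 1 / (2 * r)))) \<longlongrightarrow> 1 / (1 + c)) at_top"
proof -
  have lim: "((\<lambda>r. 1 / (1 + 2 * r * \<alpha> r)) \<longlongrightarrow> 1 / (1 + c)) at_top"
    using c by (intro tendsto_intros) auto
  have "\<forall>\<^sub>F r in at_top. 1 / (1 + 2 * r * \<alpha> r) = 1 / (2 * r * (\<alpha> r + 1 / (2 * r)))"
    using eventually_gt_at_top[of 0] by eventually_elim (simp add: algebra_simps)
  with lim show "((\<lambda>r. 1 / (2 * r * (\<alpha> r + 1 / (2 * r)))) \<longlongrightarrow> 1 / (1 + c)) at_top"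
    by (rule Lim_transform_eventually)
  have "\<forall>\<^sub>F r in at_top. 1 - 1 / (1 + 2 * r * \<alpha> r) = \<alpha> r / (\<alpha> r + 1 / (2 * r))"
    using eventually_gt_at_top[of 0]
  proof eventually_elim
    case (elim r)
    have "0 < 1 + 2 * r * \<alpha> r" using elim \<alpha>[OF elim] by (intro add_pos_pos mult_pos_pos) auto
    then show ?case using elim \<alpha>[OF elim] by (simp add: field_simps)
  qed
  with tendsto_diff[OF tendsto_const lim, of 1]
  show "((\<lambda>r. \<alpha> r / (\<alpha> r + 1 / (2 * r))) \<longlongrightarrow> 1 - 1 / (1 + c)) at_top"
    by (rule Lim_transform_eventually)
qed

lemma self_weights:
  fixes \<alpha> :: "real \<Rightarrow> real"
  assumes "filterlim (\<lambda>r. 2 * r * \<alpha> r) at_top at_top" "\<And>r. 0 < r \<Longrightarrow> 0 < \<alpha> r"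
  shows "((\<lambda>r. \<alpha> r / \<alpha> r) \<longlongrightarrow> 1) at_top" "((\<lambda>r. 1 / (2 * r * \<alpha> r)) \<longlongrightarrow> 0) at_top"
proof -
  have "\<forall>\<^sub>F r in at_top. \<alpha> r / \<alpha> r = 1"
    using eventually_gt_at_top[of 0]
  proof eventually_elim
    case (elim r)
    then show ?case using assms(2)[of r] by simp
  qed
  then show "((\<lambda>r. \<alpha> r / \<alpha> r) \<longlongrightarrow> 1) at_top" by (rule tendsto_eventually)
  show "((\<lambda>r. 1 / (2 * r * \<alpha> r)) \<longlongrightarrow> 0) at_top"
    using tendsto_inverse_0_at_top[OF assms(1)] by (simp only: inverse_eq_divide)
qed

section \<open>The equivalence of the second order conditions\<close>

theorem theorem2p6:
  fixes C Cinf L :: "real ^ 'n \<Rightarrow> real"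
  assumes "copula C"
    and "domain_of_attraction C Cinf"
    and "stable_tail_dependence Cinf L"
  shows
    "(\<forall>\<alpha>p Sp \<rho>p (cp :: ereal).
        POT_second_order C L \<alpha>p Sp \<and> regularly_varying \<alpha>p \<rho>p \<and> \<rho>p \<le> 0 \<and>
        0 \<le> cp \<and> ((\<lambda>r. ereal (2 * r * \<alpha>p r)) \<longlongrightarrow> cp) at_top \<longrightarrow>
        (cp = \<infinity> \<longrightarrow>
           BM_second_order C Cinf \<alpha>p (of_neg_log (\<lambda>x. - Cinf (vexp (- x)) * Sp x))) \<and>
        (cp = 0 \<and> (\<exists>x\<in>{0..}. L x \<noteq> L_max x) \<longrightarrow>
           ((\<exists>\<alpha>b Sb. BM_second_order C Cinf \<alpha>b Sb) \<longleftrightarrow> continuous_on {0..} (Gamma2 L)) \<and>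
           (continuous_on {0..} (Gamma2 L) \<longrightarrow>
              BM_second_order C Cinf (\<lambda>r. 1 / (2 * r))
                (of_neg_log (\<lambda>x. Cinf (vexp (- x)) * (Gamma2 L x - (L x)\<^sup>2))))) \<and>
        (0 < cp \<and> cp < \<infinity> \<and> continuous_on {0..} (Gamma2 L) \<longrightarrow>
           (let lam = 1 / (1 + real_of_ereal cp);
                Sb = of_neg_log (\<lambda>x. Cinf (vexp (- x)) *
                       (lam * (Gamma2 L x - (L x)\<^sup>2) - (1 - lam) * Sp x))
            in (\<exists>u\<in>{0..1}. Sb u \<noteq> 0) \<longrightarrow>
               BM_second_order C Cinf (\<lambda>r. \<alpha>p r + 1 / (2 * r)) Sb))) \<and>
     (\<forall>\<alpha>b Sb \<rho>b (cb :: ereal).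
        BM_second_order C Cinf \<alpha>b Sb \<and> regularly_varying \<alpha>b \<rho>b \<and> \<rho>b \<le> 0 \<and>
        0 \<le> cb \<and> ((\<lambda>r. ereal (2 * r * \<alpha>b r)) \<longlongrightarrow> cb) at_top \<longrightarrow>
        (cb = \<infinity> \<longrightarrow>
           POT_second_order C L \<alpha>b (\<lambda>x. - Sb (vexp (- x)) / Cinf (vexp (- x)))) \<and>
        (cb = 0 \<and> (\<exists>x\<in>{0..}. L x \<noteq> L_max x) \<longrightarrow>
           ((\<exists>\<alpha>p Sp. POT_second_order C L \<alpha>p Sp) \<longleftrightarrow> continuous_on {0..} (Gamma1 L)) \<and>
           (continuous_on {0..} (Gamma1 L) \<longrightarrow>
              POT_second_order C L (\<lambda>r. 1 / (2 * r)) (\<lambda>x. Gamma1 L x - (L x)\<^sup>2))) \<and>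
        (0 < cb \<and> cb < \<infinity> \<and> continuous_on {0..} (Gamma1 L) \<longrightarrow>
           (let lam = 1 / (1 + real_of_ereal cb);
                Sp = (\<lambda>x. lam * (Gamma1 L x - (L x)\<^sup>2)
                        - (1 - lam) * (Sb (vexp (- x)) / Cinf (vexp (- x))))
            in (\<exists>x\<in>{0..}. Sp x \<noteq> 0) \<longrightarrow>
               POT_second_order C L (\<lambda>r. \<alpha>b r + 1 / (2 * r)) Sp)))"
proof -
  from assms(2) have evc: "extreme_value_copula Cinf" by (simp add: domain_of_attraction_def)
  interpret stable_tail L
    by (rule stable_tail_dependence_imp_stable_tail[OF evc assms(3)])
  interpret tail_copula L C Cinf
    by unfold_locales
      (use assms evc extreme_value_copula_exp[OF assms(3)] in \<open>auto simp: extreme_value_copula_def\<close>)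
  have one_nonneg: "0 \<le> (1 :: real ^ 'n)" by (simp add: less_eq_vec_def)
  have sq: "L 1 - (L 1)\<^sup>2 \<noteq> 0" if "\<exists>x\<in>{0..}. L x \<noteq> L_max x"
    using one_less_L_one[OF that] by (simp add: power2_eq_square)
  have a_infinite: "BM_second_order C Cinf \<alpha> (of_neg_log (\<lambda>x. - Cinf (vexp (- x)) * S x))"
    if POT: "POT_second_order C L \<alpha> S" and c: "((\<lambda>r. ereal (2 * r * \<alpha> r)) \<longlongrightarrow> \<infinity>) at_top" for \<alpha> S
  proof -
    have \<alpha>: "\<And>r. 0 < r \<Longrightarrow> 0 < \<alpha> r" "(\<alpha> \<longlongrightarrow> 0) at_top" and nz: "\<exists>x\<ge>0. S x \<noteq> 0"
      using POT by (auto simp: POT_second_order_iff)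
    have "filterlim (\<lambda>r. 2 * r * \<alpha> r) at_top at_top" using c by (simp add: tendsto_PInfty_eq_at_top)
    then have w: "((\<lambda>r. \<alpha> r / \<alpha> r) \<longlongrightarrow> 1) at_top" "((\<lambda>r. 1 / (2 * r * \<alpha> r)) \<longlongrightarrow> 0) at_top"
      using self_weights \<alpha>(1) by blast+
    show ?thesis
      by (rule BM_from_POT[OF POT \<alpha> w]) (use nz Cinf_vexp in auto)
  qed
  have a_zero: "BM_second_order C Cinf (\<lambda>r. 1 / (2 * r)) (of_neg_log (\<lambda>x. Cinf (vexp (- x)) * (Gamma2 L x - (L x)\<^sup>2)))"
    if POT: "POT_second_order C L \<alpha> S" and c: "((\<lambda>r. 2 * r * \<alpha> r) \<longlongrightarrow> 0) at_top"
      and ne: "\<exists>x\<in>{0..}. L x \<noteq> L_max x" and cont: "continuous_on {0..} (Gamma2 L)" for \<alpha> S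
  proof (rule BM_from_POT[OF POT half_rate(1,2) _ half_rate(3)])
    show "((\<lambda>r. \<alpha> r / (1 / (2 * r))) \<longlongrightarrow> 0) at_top" using c by (simp add: mult.commute)
    show "\<exists>x\<ge>0. Cinf (vexp (- x)) * (Gamma2 L x - (L x)\<^sup>2) \<noteq> 0"
      using sq[OF ne] one_nonneg Gamma2_one Cinf_vexp[OF one_nonneg] by (intro exI[of _ 1]) simp
  qed (use cont Cinf_vexp in auto)
  have a_finite: "BM_second_order C Cinf (\<lambda>r. \<alpha> r + 1 / (2 * r)) (of_neg_log g)"
    if POT: "POT_second_order C L \<alpha> S" and c: "((\<lambda>r. 2 * r * \<alpha> r) \<longlongrightarrow> c) at_top" "0 \<le> c"
      and cont: "continuous_on {0..} (Gamma2 L)" and nz: "\<exists>u\<in>{0..1}. of_neg_log g u \<noteq> 0"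
      and g: "g = (\<lambda>x. Cinf (vexp (- x)) * (1 / (1 + c) * (Gamma2 L x - (L x)\<^sup>2) - (1 - 1 / (1 + c)) * S x))"
    for \<alpha> S c g
  proof -
    have \<alpha>: "\<And>r. 0 < r \<Longrightarrow> 0 < \<alpha> r" "(\<alpha> \<longlongrightarrow> 0) at_top"
      using POT by (auto simp: POT_second_order_iff)
    obtain u where u: "u \<in> {0..1}" "of_neg_log g u \<noteq> 0" using nz by blast
    then have pos: "0 < u $ i" for i unfolding of_neg_log_def by metis
    have "\<exists>x\<ge>0. g x \<noteq> 0"
      by (rule exI[of _ "\<chi> i. - ln (u $ i)"])
        (use u pos in \<open>auto simp: less_eq_vec_def ln_le_zero_iff of_neg_log_def\<close>)
    then show ?thesis
      using \<alpha> tendsto_add[OF \<alpha>(2) half_rate(2)] cont g Cinf_vexp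
      by (intro BM_from_POT[OF POT _ _ weights_of_ratio_limit[OF c \<alpha>(1)]]) (auto intro: add_pos_pos)
  qed
  have b_infinite: "POT_second_order C L \<alpha> (\<lambda>x. - S (vexp (- x)) / Cinf (vexp (- x)))"
    if BM: "BM_second_order C Cinf \<alpha> S" and c: "((\<lambda>r. ereal (2 * r * \<alpha> r)) \<longlongrightarrow> \<infinity>) at_top" for \<alpha> S
  proof -
    note BMD = BM_second_orderD[OF BM]
    have "filterlim (\<lambda>r. 2 * r * \<alpha> r) at_top at_top" using c by (simp add: tendsto_PInfty_eq_at_top)
    then have w: "((\<lambda>r. \<alpha> r / \<alpha> r) \<longlongrightarrow> 1) at_top" "((\<lambda>r. 1 / (2 * r * \<alpha> r)) \<longlongrightarrow> 0) at_top"
      using self_weights BMD(1) by blast+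
    show ?thesis
      by (rule POT_from_BM[OF BM BMD(1,2) w]) (use BMD(3) Cinf_vexp in auto)
  qed
  have b_zero: "POT_second_order C L (\<lambda>r. 1 / (2 * r)) (\<lambda>x. Gamma1 L x - (L x)\<^sup>2)"
    if BM: "BM_second_order C Cinf \<alpha> S" and c: "((\<lambda>r. 2 * r * \<alpha> r) \<longlongrightarrow> 0) at_top"
      and ne: "\<exists>x\<in>{0..}. L x \<noteq> L_max x" and cont: "continuous_on {0..} (Gamma1 L)" for \<alpha> S
  proof (rule POT_from_BM[OF BM half_rate(1,2) _ half_rate(3)])
    show "((\<lambda>r. \<alpha> r / (1 / (2 * r))) \<longlongrightarrow> 0) at_top" using c by (simp add: mult.commute)
    show "\<exists>x\<ge>0. Gamma1 L x - (L x)\<^sup>2 \<noteq> 0"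
      using sq[OF ne] one_nonneg Gamma1_one by (intro exI[of _ 1]) simp
  qed (use cont in auto)
  have b_finite: "POT_second_order C L (\<lambda>r. \<alpha> r + 1 / (2 * r)) g"
    if BM: "BM_second_order C Cinf \<alpha> S" and c: "((\<lambda>r. 2 * r * \<alpha> r) \<longlongrightarrow> c) at_top" "0 \<le> c"
      and cont: "continuous_on {0..} (Gamma1 L)" and nz: "\<exists>x\<in>{0..}. g x \<noteq> 0"
      and g: "g = (\<lambda>x. 1 / (1 + c) * (Gamma1 L x - (L x)\<^sup>2)
        - (1 - 1 / (1 + c)) * (S (vexp (- x)) / Cinf (vexp (- x))))"
    for \<alpha> S c g
  proof -
    note BMD = BM_second_orderD[OF BM]
    show ?thesis
      using BMD(1) tendsto_add[OF BMD(2) half_rate(2)] cont g Cinf_vexp nz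
      by (intro POT_from_BM[OF BM _ _ weights_of_ratio_limit[OF c BMD(1)]]) (auto intro: add_pos_pos)
  qed
  have finite_limit: "(f \<longlongrightarrow> real_of_ereal c) at_top \<and> 0 \<le> real_of_ereal c"
    if "((\<lambda>r. ereal (f r)) \<longlongrightarrow> c) at_top" "0 \<le> c" "c \<noteq> \<infinity>" for f :: "real \<Rightarrow> real" and c
    using that by (cases c) auto
  have zero_limit: "(f \<longlongrightarrow> 0) at_top" if "((\<lambda>r. ereal (f r)) \<longlongrightarrow> 0) at_top" for f :: "real \<Rightarrow> real"
    using finite_limit[OF that] by simp
  show ?thesis
  proof (intro conjI allI impI; (elim conjE)?)
    fix \<alpha> S \<rho> and c :: ereal
    assume POT: "POT_second_order C L \<alpha> S" and c: "((\<lambda>r. ereal (2 * r * \<alpha> r)) \<longlongrightarrow> c) at_top" "0 \<le> c"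
    have small: "((\<lambda>r. 2 * r * \<alpha> r) \<longlongrightarrow> 0) at_top" if "c = 0"
      using zero_limit c(1) that by simp
    have lim: "((\<lambda>r. 2 * r * \<alpha> r) \<longlongrightarrow> real_of_ereal c) at_top" "0 \<le> real_of_ereal c" if "c < \<infinity>"
      using finite_limit[OF c] that by auto
    show "BM_second_order C Cinf \<alpha> (of_neg_log (\<lambda>x. - Cinf (vexp (- x)) * S x))" if "c = \<infinity>"
      by (rule a_infinite[OF POT]) (use c that in simp)
    show "(\<exists>\<alpha>b Sb. BM_second_order C Cinf \<alpha>b Sb) \<longleftrightarrow> continuous_on {0..} (Gamma2 L)"
      if "c = 0" "\<exists>x\<in>{0..}. L x \<noteq> L_max x"
      using a_zero[OF POT small[OF that(1)] that(2)] Gamma2_continuous_of_BM[OF POT small[OF that(1)]] by blast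
    show "BM_second_order C Cinf (\<lambda>r. 1 / (2 * r)) (of_neg_log (\<lambda>x. Cinf (vexp (- x)) * (Gamma2 L x - (L x)\<^sup>2)))"
      if "c = 0" "\<exists>x\<in>{0..}. L x \<noteq> L_max x" "continuous_on {0..} (Gamma2 L)"
      by (rule a_zero[OF POT small[OF that(1)] that(2,3)])
    show "let lam = 1 / (1 + real_of_ereal c);
              Sb = of_neg_log (\<lambda>x. Cinf (vexp (- x)) * (lam * (Gamma2 L x - (L x)\<^sup>2) - (1 - lam) * S x))
          in (\<exists>u\<in>{0..1}. Sb u \<noteq> 0) \<longrightarrow> BM_second_order C Cinf (\<lambda>r. \<alpha> r + 1 / (2 * r)) Sb"
      if "c < \<infinity>" "continuous_on {0..} (Gamma2 L)"
      unfolding Let_def using a_finite[OF POT lim[OF that(1)] that(2) _ refl] by blast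
  next
    fix \<alpha> S \<rho> and c :: ereal
    assume BM: "BM_second_order C Cinf \<alpha> S" and c: "((\<lambda>r. ereal (2 * r * \<alpha> r)) \<longlongrightarrow> c) at_top" "0 \<le> c"
    have small: "((\<lambda>r. 2 * r * \<alpha> r) \<longlongrightarrow> 0) at_top" if "c = 0"
      using zero_limit c(1) that by simp
    have lim: "((\<lambda>r. 2 * r * \<alpha> r) \<longlongrightarrow> real_of_ereal c) at_top" "0 \<le> real_of_ereal c" if "c < \<infinity>"
      using finite_limit[OF c] that by auto
    show "POT_second_order C L \<alpha> (\<lambda>x. - S (vexp (- x)) / Cinf (vexp (- x)))" if "c = \<infinity>"
      by (rule b_infinite[OF BM]) (use c that in simp)
    show "(\<exists>\<alpha>p Sp. POT_second_order C L \<alpha>p Sp) \<longleftrightarrow> continuous_on {0..} (Gamma1 L)"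
      if "c = 0" "\<exists>x\<in>{0..}. L x \<noteq> L_max x"
      using b_zero[OF BM small[OF that(1)] that(2)] Gamma1_continuous_of_POT[OF BM small[OF that(1)]] by blast
    show "POT_second_order C L (\<lambda>r. 1 / (2 * r)) (\<lambda>x. Gamma1 L x - (L x)\<^sup>2)"
      if "c = 0" "\<exists>x\<in>{0..}. L x \<noteq> L_max x" "continuous_on {0..} (Gamma1 L)"
      by (rule b_zero[OF BM small[OF that(1)] that(2,3)])
    show "let lam = 1 / (1 + real_of_ereal c);
              Sp = (\<lambda>x. lam * (Gamma1 L x - (L x)\<^sup>2) - (1 - lam) * (S (vexp (- x)) / Cinf (vexp (- x))))
          in (\<exists>x\<in>{0..}. Sp x \<noteq> 0) \<longrightarrow> POT_second_order C L (\<lambda>r. \<alpha> r + 1 / (2 * r)) Sp"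
      if "c < \<infinity>" "continuous_on {0..} (Gamma1 L)"
      unfolding Let_def using b_finite[OF BM lim[OF that(1)] that(2) _ refl] by blast
  qed
qed

end
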